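(* Let $G$ be a profinite group and $A$ a commutative ring. For every open normal subgroup $N$ of $G$, the ideal $K_N$ is open in the initial vanishing topology on the Witt–Burnside ring $\mathbf W_G(A)$. If $G$ is topologically finitely generated, then the profinite topology and the initial vanishing topology on $\mathbf W_G(A)$ are the same.
   Context: Witt–Burnside rings. For a profinite group $G$, let $\mathcal F(G)$ be the set of isomorphism classes of finite discrete transitive $G$-sets (each is $G/H$, $H$ open). Write $U\le T$ if there is a $G$-map $T\to U$, and let $\varphi_T(U)$ be the number of $G$-maps $T\to U$. The $T$-th Witt polynomial is $W_T(\underline X)=\sum_{U\le T}\varphi_T(U)X_U^{\#T/\#U}$. By Dress–Siebeneicher there are unique polynomials $S_T,M_T\in\mathbf Z[\underline X,\underline Y]$ with $W_T(\underline X)+W_T(\underline Y)=W_T(\underline S)$ and $W_T(\underline X)W_T(\underline Y)=W_T(\underline M)$ for all $T$. For a commutative ring $A$, $\mathbf W_G(A)$ is the set $\prod_{T\in\mathcal F(G)}A$ with $\mathbf a+\mathbf b=(S_T(\mathbf a,\mathbf b))_T$ and $\mathbf a\mathbf b=(M_T(\mathbf a,\mathbf b))_T$; it is a commutative ring. For an open normal subgroup $N$ of $G$, $K_N=\{\mathbf a\in\mathbf W_G(A): a_T=0\text{ for all }T\le G/N\}$; it is the kernel of the coordinate projection $\mathbf W_G(A)\to\mathbf W_{G/N}(A)$. The profinite topology on $\mathbf W_G(A)$ is the topology of $\varprojlim_N\mathbf W_G(A)/K_N$ with discrete quotients, i.e. the ring topology with the ideals $K_N$ ($N$ open normal) as a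 fundamental system of neighborhoods of $0$. For $n\ge1$, $I_n(G,A)=\{\mathbf a: a_T=0\text{ whenever }\#T<n\}$, an ideal; the initial vanishing topology is the ring topology with the ideals $I_n(G,A)$, $n\ge1$, as a fundamental system of neighborhoods of $0$. *)

theory Defs
  imports "HOL-Analysis.Analysis" "HOL-Algebra.Algebra" "HOL-Library.Poly_Mapping"
begin

section \<open>Profinite groups\<close>

locale topological_group_on = group G for G (structure) +
  fixes TG :: "'a topology"
  assumes topspace_eq: "topspace TG = carrier G"
    and continuous_mult: "continuous_map (prod_topology TG TG) TG (\<lambda>(x, y). x \<otimes> y)"
    and continuous_inv: "continuous_map TG TG (\<lambda>x. inv x)"

locale profinite_group = topological_group_on +
  assumes compact: "compact_space TG"
    and hausdorff: "Hausdorff_space TG"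
    and totally_disconnected: "\<And>C. connectedin TG C \<Longrightarrow> \<exists>x. C \<subseteq> {x}"

definition topologically_fg :: "('g, 'm) monoid_scheme \<Rightarrow> 'g topology \<Rightarrow> bool" where
  "topologically_fg G TG \<longleftrightarrow>
     (\<exists>S. finite S \<and> S \<subseteq> carrier G \<and> TG closure_of (generate G S) = carrier G)"

definition open_normal :: "('g, 'm) monoid_scheme \<Rightarrow> 'g topology \<Rightarrow> 'g set \<Rightarrow> bool" where
  "open_normal G TG N \<longleftrightarrow> N \<lhd> G \<and> openin TG N"


section \<open>Finite discrete transitive sets over a topological group\<close>

text \<open>A \<open>G\<close>-set is a pair of a set of points and an action in the sense of
  \<^locale>\<open>group_action\<close>.\<close>

type_synonym ('g, 'x) gset = "'x set \<times> ('g \<Rightarrow> 'x \<Rightarrow> 'x)"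

text \<open>Discreteness means that the action is continuous for the discrete topology on the points.
  The locale \<^locale>\<open>transitive_action\<close> admits the empty set, which has to be excluded.\<close>

definition fdt_gset ::
  "('g, 'm) monoid_scheme \<Rightarrow> 'g topology \<Rightarrow> ('g, 'x) gset \<Rightarrow> bool" where
  "fdt_gset G TG P \<longleftrightarrow>
     transitive_action G (fst P) (snd P) \<and> finite (fst P) \<and> fst P \<noteq> {} \<and>
     continuous_map (prod_topology TG (discrete_topology (fst P))) (discrete_topology (fst P))
       (\<lambda>(g, x). snd P g x)"

definition gmaps ::
  "('g, 'm) monoid_scheme \<Rightarrow> ('g, 'x) gset \<Rightarrow> ('g, 'y) gset \<Rightarrow> ('x \<Rightarrow> 'y) set" where
  "gmaps G P Q = {f \<in> fst P \<rightarrow>\<^sub>E fst Q.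
     \<forall>g \<in> carrier G. \<forall>x \<in> fst P. f (snd P g x) = snd Q g (f x)}"

definition gset_iso ::
  "('g, 'm) monoid_scheme \<Rightarrow> ('g, 'x) gset \<Rightarrow> ('g, 'y) gset \<Rightarrow> bool" where
  "gset_iso G P Q \<longleftrightarrow> (\<exists>f \<in> gmaps G P Q. bij_betw f (fst P) (fst Q))"

definition coset_gset :: "('g, 'm) monoid_scheme \<Rightarrow> 'g set \<Rightarrow> ('g, 'g set) gset" where
  "coset_gset G H =
     (lcosets\<^bsub>G\<^esub> H, \<lambda>g. \<lambda>C \<in> lcosets\<^bsub>G\<^esub> H. g <#\<^bsub>G\<^esub> C)"

text \<open>Every finite discrete transitive \<open>G\<close>-set is isomorphic to some \<open>G/H\<close> with \<open>H\<close> open, whose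
  points are sets of elements of \<open>G\<close>.  Hence taking \<open>'g set\<close> as the type of points loses no
  isomorphism class.\<close>

type_synonym 'g gclass = "('g, 'g set) gset set"

definition fdt_iso :: "('g, 'm) monoid_scheme \<Rightarrow> 'g topology \<Rightarrow> ('g, 'g set) gset rel" where
  "fdt_iso G TG = {(P, Q). fdt_gset G TG P \<and> fdt_gset G TG Q \<and> gset_iso G P Q}"

definition fdt_classes :: "('g, 'm) monoid_scheme \<Rightarrow> 'g topology \<Rightarrow> 'g gclass set" where
  "fdt_classes G TG = {P. fdt_gset G TG P} // fdt_iso G TG"

definition quot_class :: "('g, 'm) monoid_scheme \<Rightarrow> 'g topology \<Rightarrow> 'g set \<Rightarrow> 'g gclass" where
  "quot_class G TG H = fdt_iso G TG `` {coset_gset G H}"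

text \<open>The cardinality, the order (\<open>U \<le> T\<close> iff there is a map \<open>T \<rightarrow> U\<close>) and the number of maps are
  invariant under isomorphism, so the choice of representatives is immaterial.\<close>

definition class_rep :: "'g gclass \<Rightarrow> ('g, 'g set) gset" where
  "class_rep T = (SOME P. P \<in> T)"

definition class_card :: "'g gclass \<Rightarrow> nat" where
  "class_card T = card (fst (class_rep T))"

definition class_le :: "('g, 'm) monoid_scheme \<Rightarrow> 'g gclass \<Rightarrow> 'g gclass \<Rightarrow> bool" where
  "class_le G U T \<longleftrightarrow> gmaps G (class_rep T) (class_rep U) \<noteq> {}"

definition num_gmaps :: "('g, 'm) monoid_scheme \<Rightarrow> 'g gclass \<Rightarrow> 'g gclass \<Rightarrow> nat" where
  "num_gmaps G T U = card (gmaps G (class_rep T) (class_rep U))"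


section \<open>Witt polynomials\<close>

text \<open>The value of the Witt polynomial \<open>W\<^sub>T\<close> at a family of elements of a commutative ring; the
  polynomial itself is the value at the family of indeterminates.  The index set of the sum is
  finite, and \<open>#U\<close> divides \<open>#T\<close> whenever \<open>U \<le> T\<close>.\<close>

definition witt_poly ::
  "('g, 'm) monoid_scheme \<Rightarrow> 'g topology \<Rightarrow> 'g gclass \<Rightarrow> ('g gclass \<Rightarrow> 'r::comm_ring_1) \<Rightarrow> 'r" where
  "witt_poly G TG T x =
     (\<Sum>U \<in> {U \<in> fdt_classes G TG. class_le G U T}.
        of_nat (num_gmaps G T U) * x U ^ (class_card T div class_card U))"

text \<open>Integer polynomials in two families of indeterminates \<open>X\<^sub>i\<close> (index \<open>Inl i\<close>) and \<open>Y\<^sub>i\<close>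
  (index \<open>Inr i\<close>): finitely supported integer functions on monomials, where a monomial is a
  finitely supported exponent function.  Multiplication of poly mappings is convolution.\<close>

type_synonym 'i poly2 = "(('i + 'i) \<Rightarrow>\<^sub>0 nat) \<Rightarrow>\<^sub>0 int"

definition var_X :: "'i \<Rightarrow> 'i poly2" where
  "var_X i = Poly_Mapping.single (Poly_Mapping.single (Inl i) 1) 1"

definition var_Y :: "'i \<Rightarrow> 'i poly2" where
  "var_Y i = Poly_Mapping.single (Poly_Mapping.single (Inr i) 1) 1"

text \<open>The families \<open>S\<close> and \<open>M\<close> of Dress and Siebeneicher; outside the index set they are set to
  \<open>0\<close> so that they are uniquely determined as total functions.\<close>

definition witt_sum_polys ::
  "('g, 'm) monoid_scheme \<Rightarrow> 'g topology \<Rightarrow> 'g gclass \<Rightarrow> 'g gclass poly2" where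
  "witt_sum_polys G TG = (THE S.
     (\<forall>T \<in> fdt_classes G TG. witt_poly G TG T var_X + witt_poly G TG T var_Y = witt_poly G TG T S) \<and>
     (\<forall>T. T \<notin> fdt_classes G TG \<longrightarrow> S T = 0))"

definition witt_prod_polys ::
  "('g, 'm) monoid_scheme \<Rightarrow> 'g topology \<Rightarrow> 'g gclass \<Rightarrow> 'g gclass poly2" where
  "witt_prod_polys G TG = (THE M.
     (\<forall>T \<in> fdt_classes G TG. witt_poly G TG T var_X * witt_poly G TG T var_Y = witt_poly G TG T M) \<and>
     (\<forall>T. T \<notin> fdt_classes G TG \<longrightarrow> M T = 0))"

definition eval_poly2 ::
  "('a, 'n) ring_scheme \<Rightarrow> ('i \<Rightarrow> 'a) \<Rightarrow> ('i \<Rightarrow> 'a) \<Rightarrow> 'i poly2 \<Rightarrow> 'a" where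
  "eval_poly2 A a b p =
     (\<Oplus>\<^bsub>A\<^esub>m \<in> Poly_Mapping.keys p.
        [Poly_Mapping.lookup p m] \<cdot>\<^bsub>A\<^esub>
          (\<Otimes>\<^bsub>A\<^esub>v \<in> Poly_Mapping.keys m. case_sum a b v [^]\<^bsub>A\<^esub> Poly_Mapping.lookup m v))"


section \<open>The Witt--Burnside ring\<close>

text \<open>Since \<open>W\<^sub>T\<close> contains the one-point \<open>G\<close>-set with coefficient \<open>1\<close>, the multiplicative unit has
  coordinate \<open>1\<close> there and \<open>0\<close> elsewhere.\<close>

definition witt_burnside ::
  "('g, 'm) monoid_scheme \<Rightarrow> 'g topology \<Rightarrow> ('a, 'n) ring_scheme \<Rightarrow> ('g gclass \<Rightarrow> 'a) ring" where
  "witt_burnside G TG A = \<lparr>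
     carrier = fdt_classes G TG \<rightarrow>\<^sub>E carrier A,
     mult = (\<lambda>a b. \<lambda>T \<in> fdt_classes G TG. eval_poly2 A a b (witt_prod_polys G TG T)),
     one = (\<lambda>T \<in> fdt_classes G TG. if class_card T = 1 then \<one>\<^bsub>A\<^esub> else \<zero>\<^bsub>A\<^esub>),
     ring.zero = (\<lambda>T \<in> fdt_classes G TG. \<zero>\<^bsub>A\<^esub>),
     add = (\<lambda>a b. \<lambda>T \<in> fdt_classes G TG. eval_poly2 A a b (witt_sum_polys G TG T))\<rparr>"

definition witt_K ::
  "('g, 'm) monoid_scheme \<Rightarrow> 'g topology \<Rightarrow> ('a, 'n) ring_scheme \<Rightarrow> 'g set \<Rightarrow>
     ('g gclass \<Rightarrow> 'a) set" where
  "witt_K G TG A N = {a \<in> carrier (witt_burnside G TG A).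
     \<forall>T \<in> fdt_classes G TG. class_le G T (quot_class G TG N) \<longrightarrow> a T = \<zero>\<^bsub>A\<^esub>}"

definition witt_I ::
  "('g, 'm) monoid_scheme \<Rightarrow> 'g topology \<Rightarrow> ('a, 'n) ring_scheme \<Rightarrow> nat \<Rightarrow>
     ('g gclass \<Rightarrow> 'a) set" where
  "witt_I G TG A n = {a \<in> carrier (witt_burnside G TG A).
     \<forall>T \<in> fdt_classes G TG. class_card T < n \<longrightarrow> a T = \<zero>\<^bsub>A\<^esub>}"


section \<open>Topologies given by a fundamental system of neighbourhoods of zero\<close>

definition nbhd_open :: "('r, 'n) ring_scheme \<Rightarrow> 'r set set \<Rightarrow> 'r set \<Rightarrow> bool" where
  "nbhd_open R \<B> V \<longleftrightarrow> V \<subseteq> carrier R \<and> (\<forall>a \<in> V. \<exists>I \<in> \<B>. a <+\<^bsub>R\<^esub> I \<subseteq> V)"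

definition nbhd_topology :: "('r, 'n) ring_scheme \<Rightarrow> 'r set set \<Rightarrow> 'r topology" where
  "nbhd_topology R \<B> = topology (nbhd_open R \<B>)"

lemma openin_nbhd_topology:
  assumes "\<And>I J. I \<in> \<B> \<Longrightarrow> J \<in> \<B> \<Longrightarrow> \<exists>L \<in> \<B>. L \<subseteq> I \<inter> J"
  shows "openin (nbhd_topology R \<B>) = nbhd_open R \<B>"
proof -
  have mono: "a <+\<^bsub>R\<^esub> L \<subseteq> a <+\<^bsub>R\<^esub> I" if "L \<subseteq> I" for a and L I
    using that by (auto simp: a_l_coset_def')
  have "istopology (nbhd_open R \<B>)"
    unfolding istopology_def
  proof (intro conjI allI impI)
    fix V W assume V: "nbhd_open R \<B> V" and W: "nbhd_open R \<B> W"
    show "nbhd_open R \<B> (V \<inter> W)"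
      unfolding nbhd_open_def
    proof (intro conjI ballI)
      show "V \<inter> W \<subseteq> carrier R"
        using V by (auto simp: nbhd_open_def)
    next
      fix a assume "a \<in> V \<inter> W"
      then obtain I J where "I \<in> \<B>" "a <+\<^bsub>R\<^esub> I \<subseteq> V" "J \<in> \<B>" "a <+\<^bsub>R\<^esub> J \<subseteq> W"
        using V W unfolding nbhd_open_def by blast
      moreover from this assms obtain L where "L \<in> \<B>" "L \<subseteq> I" "L \<subseteq> J"
        by (meson le_inf_iff)
      ultimately show "\<exists>L \<in> \<B>. a <+\<^bsub>R\<^esub> L \<subseteq> V \<inter> W"
        using mono by (meson le_inf_iff subset_trans)
    qed
  next
    fix \<V> assume *: "\<forall>V \<in> \<V>. nbhd_open R \<B> V"
    show "nbhd_open R \<B> (\<Union> \<V>)"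
      unfolding nbhd_open_def
    proof (intro conjI ballI)
      show "\<Union> \<V> \<subseteq> carrier R"
        using * by (auto simp: nbhd_open_def)
    next
      fix a assume "a \<in> \<Union> \<V>"
      then obtain V where "V \<in> \<V>" "a \<in> V" by blast
      moreover from this * obtain I where "I \<in> \<B>" "a <+\<^bsub>R\<^esub> I \<subseteq> V"
        unfolding nbhd_open_def by blast
      ultimately show "\<exists>I \<in> \<B>. a <+\<^bsub>R\<^esub> I \<subseteq> \<Union> \<V>" by blast
    qed
  qed
  then show ?thesis
    by (simp add: nbhd_topology_def topology_inverse')
qed

definition profinite_topology ::
  "('g, 'm) monoid_scheme \<Rightarrow> 'g topology \<Rightarrow> ('a, 'n) ring_scheme \<Rightarrow>
     ('g gclass \<Rightarrow> 'a) topology" where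
  "profinite_topology G TG A =
     nbhd_topology (witt_burnside G TG A) {witt_K G TG A N | N. open_normal G TG N}"

definition initial_vanishing_topology ::
  "('g, 'm) monoid_scheme \<Rightarrow> 'g topology \<Rightarrow> ('a, 'n) ring_scheme \<Rightarrow>
     ('g gclass \<Rightarrow> 'a) topology" where
  "initial_vanishing_topology G TG A =
     nbhd_topology (witt_burnside G TG A) {witt_I G TG A n | n. 1 \<le> n}"

end

theory Submission
  imports Defs
begin

text \<open>
  A class \<open>T \<le> G/N\<close> is a quotient of \<open>G/N\<close> and has at most \<open>card (G/N)\<close> points, so
  \<open>I\<^sub>n \<subseteq> K\<^sub>N\<close> for \<open>n > card (G/N)\<close>.  It remains to see that \<open>K\<^sub>N\<close> is closed under addition
  (\<open>witt_K_add\<close>), and this holds if \<open>S\<^sub>T\<close> involves only variables with index \<open>U \<le> T\<close> and has no constant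
  term (\<open>witt_sum_polys_in\<close>).  That is easily read off from the equations that define \<open>S\<close>, once these
  equations are known to have an integral solution.  Most of the work is the proof of this
  theorem of Dress and Siebeneicher (\<open>witt_sum_polys\<close>).

  Solving \<open>W\<^sub>T(S) = b\<^sub>T\<close> recursively for \<open>S\<^sub>T\<close> requires a division by the number of
  automorphisms of \<open>T\<close>.  A family \<open>b\<close> of integral polynomials has an integral solution \<open>S\<close> if, for all \<open>T\<close>,
  the sum of \<open>\<psi>\<^sup>k(b\<^sub>V)\<close> over all automorphisms \<open>s\<close> of \<open>T\<close> is divisible by their number, where
  \<open>V = T/\<langle>s\<rangle>\<close> is the set of orbits, \<open>k = card T / card V\<close> is the order of \<open>s\<close>, and \<open>\<psi>\<^sup>k\<close> raises all
  variables to the power \<open>k\<close> (\<open>ghost_image\<close>).  These conditions are linear in \<open>b\<close>, so it suffices to verify them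
  for the values \<open>b\<^sub>T = W\<^sub>T(x)\<close> at an arbitrary family \<open>x\<close> (\<open>ghost_congruence\<close>).  They then reduce to one class
  \<open>U\<close> at a time.  If \<open>x\<^sub>U\<close> is a sum of monomials, regarded as colours, then \<open>(\<psi>\<^sup>k x\<^sub>U) ^ (card V / card U)\<close>,
  multiplied by the number of \<open>G\<close>-maps \<open>V \<rightarrow> U\<close>, enumerates the pairs fixed by \<open>s\<close> among all pairs of a \<open>G\<close>-map
  \<open>T \<rightarrow> U\<close> and a colouring of its fibre over a fixed point.  Burnside's lemma for the automorphism
  group of \<open>T\<close> gives the divisibility (\<open>burnside_congruence\<close>).

  If \<open>G\<close> is topologically finitely generated, only finitely many classes have fewer
  than \<open>n\<close> points, since each is given by permutations assigned to the generators
  (\<open>finite_small_classes\<close>).  The common kernel \<open>N\<close> of the actions on them is open and normal, all of them are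
  quotients of \<open>G/N\<close>, and hence \<open>K\<^sub>N \<subseteq> I\<^sub>n\<close>.  Together with \<open>I\<^sub>m \<subseteq> K\<^sub>N\<close> for large \<open>m\<close> this makes the two
  systems of neighbourhoods equivalent.
\<close>

section \<open>Adams operations on integral monoid rings\<close>

text \<open>The Adams operation \<open>\<psi>\<^sup>n\<close> of the monoid ring \<open>\<int>[M]\<close>, where \<open>\<int>[M]\<close> is the type \<open>'m \<Rightarrow>\<^sub>0 int\<close> and
  \<open>frag_of m\<close> is the monomial \<open>m\<close>.\<close>

definition adams :: "nat \<Rightarrow> ('m::comm_monoid_add \<Rightarrow>\<^sub>0 int) \<Rightarrow> ('m \<Rightarrow>\<^sub>0 int)" where
  "adams n = frag_extend (\<lambda>m. frag_of m ^ n)"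

lemma adams_zero [simp]: "adams n 0 = 0"
  by (simp add: adams_def)

lemma adams_diff: "adams n (x - y) = adams n x - adams n y"
  by (simp add: adams_def frag_extend_diff)

lemma adams_add: "adams n (x + y) = adams n x + adams n y"
  by (simp add: adams_def frag_extend_add)

lemma adams_sum: "adams n (sum f I) = (\<Sum>i\<in>I. adams n (f i))"
  by (induction I rule: infinite_finite_induct) (simp_all add: adams_add)

lemma adams_frag_of [simp]: "adams n (frag_of m) = frag_of m ^ n"
  by (simp add: adams_def)

lemma adams_1 [simp]: "adams (Suc 0) x = x"
  unfolding adams_def by (simp flip: frag_expansion)

lemma adams_mult: "adams n (x * y) = adams n x * adams n y"
  using subset_UNIV[of "Poly_Mapping.keys x"]
proof (induction x rule: frag_induction)
  case (one m)
  show ?case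
    using subset_UNIV[of "Poly_Mapping.keys y"]
  proof (induction y rule: frag_induction)
    case (one m')
    have "frag_of m * frag_of m' = frag_of (m + m')"
      by (simp add: mult_single)
    then show ?case
      by (metis adams_frag_of power_mult_distrib)
  qed (simp_all add: adams_diff algebra_simps)
qed (simp_all add: adams_diff algebra_simps)

lemma adams_one [simp]: "adams n 1 = 1"
proof -
  have "(1 :: 'a \<Rightarrow>\<^sub>0 int) = frag_of 0"
    by simp
  then show ?thesis
    by (metis adams_frag_of power_one)
qed

lemma adams_power: "adams n (x ^ k) = adams n x ^ k"
  by (induction k) (simp_all add: adams_mult)

lemma adams_of_nat [simp]: "adams n (of_nat k) = of_nat k"
  by (induction k) (simp_all add: adams_add)

lemma adams_dvd: "of_nat N dvd x - y \<Longrightarrow> of_nat N dvd adams n x - adams n y"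
  by (metis adams_diff adams_mult adams_of_nat dvd_def)

lemma dvd_diff_power:
  fixes x y d :: "'r::comm_ring_1"
  assumes "d dvd x - y"
  shows "d dvd x ^ k - y ^ k"
proof (induction k)
  case (Suc k)
  have "x ^ Suc k - y ^ Suc k = x * (x ^ k - y ^ k) + (x - y) * y ^ k"
    by (simp add: algebra_simps)
  then show ?case
    using Suc assms by (metis dvd_add dvd_mult dvd_mult2)
qed simp

text \<open>The counting arguments below need polynomials that enumerate the elements of a finite set, that
  is, sums of monomials without signs.  For divisibility by \<open>N\<close> this costs no generality, because
  \<open>-1\<close> is congruent to \<open>N - 1\<close>.\<close>

lemma monomial_sum_mod:
  fixes x :: "'m::comm_monoid_add \<Rightarrow>\<^sub>0 int"
  assumes "N > 0"
  obtains \<mu> :: "nat \<Rightarrow> 'm" and k where "of_nat N dvd x - (\<Sum>i<k. frag_of (\<mu> i))"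
proof -
  have "\<exists>ms. of_nat N dvd x - (\<Sum>m\<leftarrow>ms. frag_of m)"
    using subset_UNIV[of "Poly_Mapping.keys x"]
  proof (induction x rule: frag_induction)
    case zero
    show ?case by (rule exI[of _ "[]"]) simp
  next
    case (one m)
    show ?case by (rule exI[of _ "[m]"]) simp
  next
    case (diff a b)
    then obtain as bs where as: "of_nat N dvd a - (\<Sum>m\<leftarrow>as. frag_of m)"
      and bs: "of_nat N dvd b - (\<Sum>m\<leftarrow>bs. frag_of m)" by blast
    define s t where "s = (\<Sum>m\<leftarrow>as. frag_of m)" and "t = (\<Sum>m\<leftarrow>bs. frag_of m)"
    \<comment> \<open>Modulo \<open>N\<close> the subtraction of \<open>t\<close> is the addition of \<open>N - 1\<close> copies of \<open>t\<close>.\<close>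
    have "(\<Sum>m\<leftarrow>as @ concat (replicate (N - 1) bs). frag_of m) = s + of_nat (N - 1) * t"
    proof -
      have "(\<Sum>m\<leftarrow>concat (replicate k bs). frag_of m) = of_nat k * t" for k
        by (induction k) (simp_all add: t_def algebra_simps)
      then show ?thesis by (simp add: s_def)
    qed
    moreover have "a - b - (s + of_nat (N - 1) * t) = (a - s) - (b - t) - of_nat N * t"
      using \<open>N > 0\<close> by (simp add: algebra_simps of_nat_diff)
    ultimately show ?case
      using as bs unfolding s_def[symmetric] t_def[symmetric] by (metis dvd_diff dvd_triv_left)
  qed
  then obtain ms where "of_nat N dvd x - (\<Sum>m\<leftarrow>ms. frag_of m)" by blast
  moreover have "(\<Sum>m\<leftarrow>ms. frag_of m) = (\<Sum>i<length ms. frag_of (ms ! i))"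
    by (simp add: sum_list_sum_nth atLeast0LessThan)
  ultimately show ?thesis
    using that[of "(!) ms" "length ms"] by simp
qed

section \<open>Burnside's lemma with weights\<close>

text \<open>Burnside's lemma with weights.  Interchanging the sums counts each \<open>z\<close> with the order of its
  stabilizer, so an orbit with common weight \<open>w\<close> contributes (length of the orbit) times (order of a
  stabilizer) times \<open>w\<close>, which is \<open>card K\<close> times \<open>w\<close>.  The group \<open>K\<close> is presented as a finite
  cancellative monoid; cancellation makes each translation of \<open>K\<close> a bijection, which provides the
  inverses.\<close>

lemma weighted_burnside:
  fixes act :: "'k \<Rightarrow> 'z \<Rightarrow> 'z" and w :: "'z \<Rightarrow> 'r::comm_ring_1"
  assumes K: "finite K" "e \<in> K" and Z: "finite Z"
    and closed: "\<And>g z. g \<in> K \<Longrightarrow> z \<in> Z \<Longrightarrow> act g z \<in> Z"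
    and one: "\<And>z. z \<in> Z \<Longrightarrow> act e z = z"
    and op: "\<And>g h. g \<in> K \<Longrightarrow> h \<in> K \<Longrightarrow> op g h \<in> K"
    and cancel: "\<And>h. h \<in> K \<Longrightarrow> inj_on (\<lambda>g. op g h) K"
    and op_act: "\<And>g h z. g \<in> K \<Longrightarrow> h \<in> K \<Longrightarrow> z \<in> Z \<Longrightarrow> act (op g h) z = act g (act h z)"
    and inv: "\<And>g z. g \<in> K \<Longrightarrow> z \<in> Z \<Longrightarrow> w (act g z) = w z"
  shows "of_nat (card K) dvd (\<Sum>g\<in>K. \<Sum>z\<in>{z \<in> Z. act g z = z}. w z)"
proof -
  have bij: "bij_betw (\<lambda>g. op g h) K K" if "h \<in> K" for h
    using cancel[OF that] op that K(1) endo_inj_surj[of K "\<lambda>g. op g h"]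
    by (auto simp: bij_betw_def)
  define r where "r = {(z, z'). z \<in> Z \<and> z' \<in> Z \<and> (\<exists>g\<in>K. act g z = z')}"
  have r: "equiv Z r"
  proof (rule equivI)
    show "r \<subseteq> Z \<times> Z" by (auto simp: r_def)
    show "refl_on Z r" using one K by (auto simp: r_def refl_on_def)
    show "sym r"
    proof (rule symI)
      fix z z' assume "(z, z') \<in> r"
      then obtain h where h: "h \<in> K" "act h z = z'" "z \<in> Z" "z' \<in> Z" by (auto simp: r_def)
      obtain g where "g \<in> K" "op g h = e"
        using bij[OF h(1)] K(2) by (metis bij_betw_imp_surj_on imageE)
      then have "act g z' = z" using h one[OF h(3)] op_act[of g h z] by simp
      then show "(z', z) \<in> r" using h \<open>g \<in> K\<close> by (auto simp: r_def)
    qed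
    show "trans r"
    proof (rule transI)
      fix x y z assume "(x, y) \<in> r" "(y, z) \<in> r"
      then obtain h g where "h \<in> K" "g \<in> K" "x \<in> Z" "z \<in> Z" "act h x = y" "act g y = z"
        by (auto simp: r_def)
      moreover from this have "act (op g h) x = z" using op_act[of g h x] by simp
      ultimately show "(x, z) \<in> r" using op[of g h] by (auto simp: r_def)
    qed
  qed
  \<comment> \<open>Right translation by an \<open>h\<close> with \<open>h z0 = z\<close> identifies the stabilizer of \<open>z\<close> with the set of
    elements that carry \<open>z0\<close> to \<open>z\<close>.\<close>
  have stab: "card {g \<in> K. act g z = z} = card {g \<in> K. act g z0 = z}" if z: "(z0, z) \<in> r" for z0 z
  proof -
    obtain h where h: "h \<in> K" "act h z0 = z" "z0 \<in> Z" "z \<in> Z" using z by (auto simp: r_def)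
    have "bij_betw (\<lambda>g. op g h) {g \<in> K. act g z = z} {g \<in> K. act g z0 = z}"
      unfolding bij_betw_def
    proof
      show "inj_on (\<lambda>g. op g h) {g \<in> K. act g z = z}"
        using cancel[OF h(1)] by (rule inj_on_subset) auto
      show "(\<lambda>g. op g h) ` {g \<in> K. act g z = z} = {g \<in> K. act g z0 = z}"
      proof (intro equalityI subsetI)
        fix k assume k: "k \<in> {g \<in> K. act g z0 = z}"
        then obtain g where g: "g \<in> K" "op g h = k"
          using bij[OF h(1)] by (metis (no_types, lifting) bij_betw_imp_surj_on imageE mem_Collect_eq)
        then have "act g z = z" using k h(2) op_act[OF g(1) h(1,3)] by simp
        then show "k \<in> (\<lambda>g. op g h) ` {g \<in> K. act g z = z}" using g by blast
      next
        fix k assume "k \<in> (\<lambda>g. op g h) ` {g \<in> K. act g z = z}"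
        then obtain g where g: "g \<in> K" "act g z = z" "k = op g h" by blast
        then show "k \<in> {g \<in> K. act g z0 = z}"
          using h(2) op_act[OF g(1) h(1,3)] op[OF g(1) h(1)] by simp
      qed
    qed
    then show ?thesis by (rule bij_betw_same_card)
  qed
  have "(\<Sum>g\<in>K. \<Sum>z\<in>{z \<in> Z. act g z = z}. w z) = (\<Sum>g\<in>K. \<Sum>z\<in>Z. if act g z = z then w z else 0)"
    using Z by (simp add: sum.inter_filter)
  also have "\<dots> = (\<Sum>z\<in>Z. \<Sum>g\<in>K. if act g z = z then w z else 0)"
    by (rule sum.swap)
  also have "\<dots> = (\<Sum>z\<in>Z. of_nat (card {g \<in> K. act g z = z}) * w z)"
    using K by (simp add: sum.inter_filter[symmetric])
  also have "\<dots> = (\<Sum>C\<in>Z // r. \<Sum>z\<in>C. of_nat (card {g \<in> K. act g z = z}) * w z)"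
  proof -
    have "\<forall>C\<in>Z // r. finite C" using finite_equiv_class[OF Z] r equiv_type by blast
    moreover have "\<forall>C\<in>Z // r. \<forall>D\<in>Z // r. C \<noteq> D \<longrightarrow> C \<inter> D = {}"
      using quotient_disj[OF r] by blast
    ultimately show ?thesis
      using sum.Union_disjoint[of "Z // r" "\<lambda>z. of_nat (card {g \<in> K. act g z = z}) * w z"]
      by (simp add: Union_quotient[OF r])
  qed
  also have "of_nat (card K) dvd \<dots>"
  proof (rule dvd_sum)
    fix C assume C: "C \<in> Z // r"
    then obtain z0 where z0: "z0 \<in> Z" "C = r `` {z0}" by (auto simp: quotient_def)
    have finC: "finite C" using z0 Z by (auto simp: r_def intro: finite_subset)
    have "(\<Sum>z\<in>C. of_nat (card {g \<in> K. act g z = z}) * w z)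
        = (\<Sum>z\<in>C. of_nat (card {g \<in> K. act g z0 = z}) * w z0)"
    proof (rule sum.cong)
      fix z assume "z \<in> C"
      then have z: "(z0, z) \<in> r" using z0 by auto
      then have "w z = w z0" using inv by (auto simp: r_def)
      then show "of_nat (card {g \<in> K. act g z = z}) * w z = of_nat (card {g \<in> K. act g z0 = z}) * w z0"
        using stab[OF z] by simp
    qed simp
    also have "\<dots> = of_nat (\<Sum>z\<in>C. card {g \<in> K. act g z0 = z}) * w z0"
      by (simp add: sum_distrib_right)
    also have "(\<Sum>z\<in>C. card {g \<in> K. act g z0 = z}) = card (\<Union>z\<in>C. {g \<in> K. act g z0 = z})"
      using K finC by (intro card_UN_disjoint[symmetric]) auto
    also have "(\<Union>z\<in>C. {g \<in> K. act g z0 = z}) = K"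
      using z0 closed by (auto simp: r_def)
    finally show "of_nat (card K) dvd (\<Sum>z\<in>C. of_nat (card {g \<in> K. act g z = z}) * w z)"
      by simp
  qed
  finally show ?thesis .
qed

section \<open>Finite discrete transitive sets and their classes\<close>

context topological_group_on
begin

text \<open>The homomorphism into the group of permutations and the continuity of the action are traded for
  elementary conditions: the laws of an action, and openness of each set \<open>{g. g x = y}\<close>.\<close>

lemma
  assumes "fdt_gset G TG P"
  shows fdt_finite: "finite (fst P)"
    and fdt_nonempty: "fst P \<noteq> {}"
    and fdt_closed: "g \<in> carrier G \<Longrightarrow> x \<in> fst P \<Longrightarrow> snd P g x \<in> fst P"
    and fdt_one: "x \<in> fst P \<Longrightarrow> snd P \<one> x = x"
    and fdt_mult: "g \<in> carrier G \<Longrightarrow> h \<in> carrier G \<Longrightarrow> x \<in> fst P \<Longrightarrow>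
                     snd P (g \<otimes> h) x = snd P g (snd P h x)"
    and fdt_transitive: "x \<in> fst P \<Longrightarrow> y \<in> fst P \<Longrightarrow> \<exists>g\<in>carrier G. snd P g x = y"
    and fdt_open: "x \<in> fst P \<Longrightarrow> y \<in> fst P \<Longrightarrow> openin TG {g \<in> carrier G. snd P g x = y}"
proof -
  interpret transitive_action G "fst P" "snd P"
    using assms by (simp add: fdt_gset_def)
  show "finite (fst P)" "fst P \<noteq> {}"
    using assms by (auto simp: fdt_gset_def)
  show "g \<in> carrier G \<Longrightarrow> x \<in> fst P \<Longrightarrow> snd P g x \<in> fst P"
    using surj_prop by auto
  show "x \<in> fst P \<Longrightarrow> snd P \<one> x = x"
    by (simp flip: id_eq_one)
  show "g \<in> carrier G \<Longrightarrow> h \<in> carrier G \<Longrightarrow> x \<in> fst P \<Longrightarrow>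
    snd P (g \<otimes> h) x = snd P g (snd P h x)"
    by (rule composition_rule)
  show "x \<in> fst P \<Longrightarrow> y \<in> fst P \<Longrightarrow> \<exists>g\<in>carrier G. snd P g x = y"
    by (rule unique_orbit)
  show "openin TG {g \<in> carrier G. snd P g x = y}" if x: "x \<in> fst P" and y: "y \<in> fst P"
  proof -
    have "continuous_map TG (prod_topology TG (discrete_topology (fst P))) (\<lambda>g. (g, x))"
      using x by (simp add: continuous_map_pairwise o_def)
    then have "continuous_map TG (discrete_topology (fst P)) ((\<lambda>(g, x). snd P g x) \<circ> (\<lambda>g. (g, x)))"
      using assms by (intro continuous_map_compose) (auto simp: fdt_gset_def)
    then have "openin TG {g \<in> topspace TG. ((\<lambda>(g, x). snd P g x) \<circ> (\<lambda>g. (g, x))) g \<in> {y}}"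
      by (rule openin_continuous_map_preimage) (use y in simp)
    then show ?thesis by (simp add: topspace_eq)
  qed
qed

lemma fdt_gsetI:
  assumes fin: "finite E" and "E \<noteq> {}"
    and ext: "\<And>g. g \<in> carrier G \<Longrightarrow> a g \<in> extensional E"
    and closed: "\<And>g x. g \<in> carrier G \<Longrightarrow> x \<in> E \<Longrightarrow> a g x \<in> E"
    and one: "\<And>x. x \<in> E \<Longrightarrow> a \<one> x = x"
    and mult: "\<And>g h x. g \<in> carrier G \<Longrightarrow> h \<in> carrier G \<Longrightarrow> x \<in> E \<Longrightarrow> a (g \<otimes> h) x = a g (a h x)"
    and trans: "\<And>x y. x \<in> E \<Longrightarrow> y \<in> E \<Longrightarrow> \<exists>g\<in>carrier G. a g x = y"
    and "open": "\<And>x y. x \<in> E \<Longrightarrow> y \<in> E \<Longrightarrow> openin TG {g \<in> carrier G. a g x = y}"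
  shows "fdt_gset G TG (E, a)"
proof -
  have inv: "a g (a (inv g) x) = x" "a (inv g) (a g x) = x" if "g \<in> carrier G" "x \<in> E" for g x
    using that one mult[of g "inv g" x] mult[of "inv g" g x] by simp_all
  have bij: "bij_betw (a g) E E" if g: "g \<in> carrier G" for g
    by (rule bij_betw_byWitness[where f' = "a (inv g)"]) (use g inv closed in auto)
  have "a \<in> hom G (BijGroup E)"
  proof (rule homI)
    show "a g \<in> carrier (BijGroup E)" if "g \<in> carrier G" for g
      using bij[OF that] ext[OF that] by (simp add: BijGroup_def Bij_def)
    show "a (g \<otimes> h) = a g \<otimes>\<^bsub>BijGroup E\<^esub> a h" if g: "g \<in> carrier G" and h: "h \<in> carrier G" for g h
    proof -
      have "a (g \<otimes> h) = compose E (a g) (a h)"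
        using g h ext mult by (intro extensionalityI[of _ E]) (auto simp: compose_def)
      then show ?thesis
        using g h bij ext by (simp add: BijGroup_def Bij_def)
    qed
  qed
  then have "transitive_action G E a"
    using trans group_BijGroup is_group
    by (simp add: transitive_action_def transitive_action_axioms_def group_action_def
        group_hom_def group_hom_axioms_def)
  moreover have "continuous_map (prod_topology TG (discrete_topology E)) (discrete_topology E) (\<lambda>(g, x). a g x)"
    unfolding continuous_map_def
  proof (intro conjI allI impI)
    show "(\<lambda>(g, x). a g x) \<in> topspace (prod_topology TG (discrete_topology E)) \<rightarrow> topspace (discrete_topology E)"
      using closed by (auto simp: topspace_eq)
    fix U assume "openin (discrete_topology E) U"
    then have U: "U \<subseteq> E" by simp
    have "{p \<in> topspace (prod_topology TG (discrete_topology E)). (\<lambda>(g, x). a g x) p \<in> U}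
        = (\<Union>x\<in>E. \<Union>y\<in>U. {g \<in> carrier G. a g x = y} \<times> {x})"
      by (auto simp: topspace_eq)
    also have "openin (prod_topology TG (discrete_topology E)) \<dots>"
      using U "open" by (auto intro!: openin_Union simp: openin_prod_Times_iff subset_iff)
    finally show "openin (prod_topology TG (discrete_topology E))
        {p \<in> topspace (prod_topology TG (discrete_topology E)). (\<lambda>(g, x). a g x) p \<in> U}" .
  qed
  ultimately show ?thesis
    using assms by (simp add: fdt_gset_def)
qed

lemma gmapsD:
  assumes "f \<in> gmaps G P Q"
  shows "f \<in> extensional (fst P)" "x \<in> fst P \<Longrightarrow> f x \<in> fst Q"
    "g \<in> carrier G \<Longrightarrow> x \<in> fst P \<Longrightarrow> f (snd P g x) = snd Q g (f x)"
  using assms by (auto simp: gmaps_def PiE_def)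

lemma gmapsI:
  assumes "f \<in> extensional (fst P)" "\<And>x. x \<in> fst P \<Longrightarrow> f x \<in> fst Q"
    "\<And>g x. g \<in> carrier G \<Longrightarrow> x \<in> fst P \<Longrightarrow> f (snd P g x) = snd Q g (f x)"
  shows "f \<in> gmaps G P Q"
  using assms by (auto simp: gmaps_def PiE_def)

lemma gmaps_finite: "finite (fst P) \<Longrightarrow> finite (fst Q) \<Longrightarrow> finite (gmaps G P Q)"
  unfolding gmaps_def by (rule finite_subset[of _ "fst P \<rightarrow>\<^sub>E fst Q"]) (auto intro: finite_PiE)

lemma gmaps_id: "fdt_gset G TG P \<Longrightarrow> (\<lambda>x\<in>fst P. x) \<in> gmaps G P P"
  by (rule gmapsI) (auto simp: fdt_closed)

lemma gmaps_compose:
  assumes "fdt_gset G TG P" "f \<in> gmaps G P Q" "h \<in> gmaps G Q R"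
  shows "compose (fst P) h f \<in> gmaps G P R"
  using assms by (intro gmapsI) (auto simp: compose_def gmapsD fdt_closed)

text \<open>The image of a \<open>G\<close>-map is a union of orbits, and a transitive target has only one.\<close>

lemma gmaps_surj:
  assumes "fdt_gset G TG P" "fdt_gset G TG Q" "f \<in> gmaps G P Q"
  shows "f ` fst P = fst Q"
proof
  show "fst Q \<subseteq> f ` fst P"
  proof
    fix y assume y: "y \<in> fst Q"
    obtain x where x: "x \<in> fst P" using fdt_nonempty assms by blast
    then obtain g where "g \<in> carrier G" "snd Q g (f x) = y"
      using fdt_transitive[OF assms(2) _ y] gmapsD(2)[OF assms(3)] by blast
    then show "y \<in> f ` fst P"
      using x gmapsD(3)[OF assms(3)] fdt_closed[OF assms(1)] by (metis imageI)
  qed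
qed (use gmapsD[OF assms(3)] in auto)

text \<open>The element of \<open>G\<close> that carries \<open>y\<close> to \<open>z\<close> also carries the fibre over \<open>y\<close> into the fibre
  over \<open>z\<close>, so all fibres have the same size.\<close>

lemma gmaps_fibre_card:
  assumes "fdt_gset G TG P" "fdt_gset G TG Q" "f \<in> gmaps G P Q" and y: "y \<in> fst Q"
  shows "card {x \<in> fst P. f x = y} * card (fst Q) = card (fst P)"
proof -
  have le: "card {x \<in> fst P. f x = y} \<le> card {x \<in> fst P. f x = z}"
    if y: "y \<in> fst Q" and z: "z \<in> fst Q" for y z
  proof -
    obtain g where g: "g \<in> carrier G" "snd Q g y = z"
      using fdt_transitive[OF assms(2) y z] by blast
    have "inj_on (snd P g) (fst P)"
      by (rule inj_on_inverseI[where g = "snd P (inv g)"])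
        (use g assms(1) in \<open>simp flip: fdt_mult add: fdt_one\<close>)
    moreover have "snd P g ` {x \<in> fst P. f x = y} \<subseteq> {x \<in> fst P. f x = z}"
      using g assms by (auto simp: gmapsD fdt_closed)
    ultimately show ?thesis
      using fdt_finite[OF assms(1)] by (intro card_inj_on_le[of "snd P g"]) (auto intro: inj_on_subset)
  qed
  have "card (fst P) = card (\<Union>z\<in>fst Q. {x \<in> fst P. f x = z})"
    using gmapsD[OF assms(3)] by (intro arg_cong[where f = card]) auto
  also have "\<dots> = (\<Sum>z\<in>fst Q. card {x \<in> fst P. f x = z})"
    using assms by (intro card_UN_disjoint) (auto simp: fdt_finite)
  also have "\<dots> = (\<Sum>z\<in>fst Q. card {x \<in> fst P. f x = y})"
    using le y by (intro sum.cong) (auto intro: le_antisym)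
  finally show ?thesis by simp
qed

lemma gmaps_factor:
  assumes P: "fdt_gset G TG P" and V: "fdt_gset G TG V" and p: "p \<in> gmaps G P V" and f: "f \<in> gmaps G P U"
    and ker: "\<And>s t. s \<in> fst P \<Longrightarrow> t \<in> fst P \<Longrightarrow> p s = p t \<Longrightarrow> f s = f t"
  shows "\<exists>h\<in>gmaps G V U. \<forall>x\<in>fst P. h (p x) = f x"
proof -
  define h where "h = (\<lambda>v\<in>fst V. f (inv_into (fst P) p v))"
  have surj: "p ` fst P = fst V" using gmaps_surj[OF P V p] .
  have h: "h (p x) = f x" if "x \<in> fst P" for x
    using that surj gmapsD(2)[OF p] ker[of "inv_into (fst P) p (p x)" x]
    by (simp add: h_def inv_into_into f_inv_into_f)
  have "h \<in> gmaps G V U"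
  proof (rule gmapsI)
    show "h \<in> extensional (fst V)" by (simp add: h_def)
    show "h v \<in> fst U" if "v \<in> fst V" for v
      using that surj h gmapsD(2)[OF f] by force
    show "h (snd V g v) = snd U g (h v)" if gv: "g \<in> carrier G" "v \<in> fst V" for g v
    proof -
      obtain x where x: "x \<in> fst P" "v = p x" using gv surj by auto
      then have "h (snd V g v) = f (snd P g x)"
        using gv h[OF fdt_closed[OF P gv(1) x(1)]] gmapsD(3)[OF p gv(1) x(1)] by simp
      then show ?thesis using h[OF x(1)] x gmapsD(3)[OF f gv(1) x(1)] by simp
    qed
  qed
  then show ?thesis using h by blast
qed

lemma gset_iso_refl: "fdt_gset G TG P \<Longrightarrow> gset_iso G P P"
  unfolding gset_iso_def by (rule bexI[OF _ gmaps_id]) (auto simp: bij_betw_def inj_on_def)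

lemma gset_iso_trans:
  assumes "fdt_gset G TG P" "gset_iso G P Q" "gset_iso G Q R"
  shows "gset_iso G P R"
proof -
  obtain f h where "f \<in> gmaps G P Q" "bij_betw f (fst P) (fst Q)" "h \<in> gmaps G Q R" "bij_betw h (fst Q) (fst R)"
    using assms by (auto simp: gset_iso_def)
  then show ?thesis
    unfolding gset_iso_def by (meson assms(1) gmaps_compose bij_betw_compose)
qed

lemma gset_iso_sym:
  assumes P: "fdt_gset G TG P" and Q: "fdt_gset G TG Q" and "gset_iso G P Q"
  shows "gset_iso G Q P"
proof -
  obtain f where f: "f \<in> gmaps G P Q" "bij_betw f (fst P) (fst Q)"
    using assms by (auto simp: gset_iso_def)
  have "\<exists>h\<in>gmaps G Q P. \<forall>x\<in>fst P. h (f x) = (\<lambda>x\<in>fst P. x) x"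
    by (rule gmaps_factor[OF P Q f(1) gmaps_id[OF P]]) (use f in \<open>auto simp: bij_betw_def inj_on_def\<close>)
  then obtain h where h: "h \<in> gmaps G Q P" "\<forall>x\<in>fst P. h (f x) = x" by auto
  have "f (h y) = y" if "y \<in> fst Q" for y
    using that f(2) h(2) unfolding bij_betw_def by (metis imageE)
  then have "bij_betw h (fst Q) (fst P)"
    by (intro bij_betw_byWitness[where f' = f])
      (use h(2) gmapsD(2)[OF f(1)] gmapsD(2)[OF h(1)] in auto)
  then show ?thesis using h by (auto simp: gset_iso_def)
qed

lemma equiv_fdt_iso: "equiv {P. fdt_gset G TG P} (fdt_iso G TG)"
proof (rule equivI)
  show "refl_on {P. fdt_gset G TG P} (fdt_iso G TG)"
    by (auto simp: refl_on_def fdt_iso_def gset_iso_refl)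
  show "sym (fdt_iso G TG)" by (auto simp: sym_def fdt_iso_def gset_iso_sym)
  show "trans (fdt_iso G TG)" unfolding trans_def fdt_iso_def using gset_iso_trans by blast
qed (auto simp: fdt_iso_def)

lemma fdt_class_rep:
  assumes "T \<in> fdt_classes G TG"
  shows "class_rep T \<in> T" "fdt_gset G TG (class_rep T)"
proof -
  show "class_rep T \<in> T"
    using assms equiv_Eps_in[OF equiv_fdt_iso] by (simp add: class_rep_def fdt_classes_def)
  then show "fdt_gset G TG (class_rep T)"
    using assms in_quotient_imp_subset[OF equiv_fdt_iso] by (auto simp: fdt_classes_def)
qed

lemma fdt_classes_eqI:
  assumes "T \<in> fdt_classes G TG" "U \<in> fdt_classes G TG" "gset_iso G (class_rep T) (class_rep U)"
  shows "T = U"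
proof (rule quotient_eqI[OF equiv_fdt_iso])
  show "T \<in> {P. fdt_gset G TG P} // fdt_iso G TG" "U \<in> {P. fdt_gset G TG P} // fdt_iso G TG"
    using assms by (simp_all add: fdt_classes_def)
  show "class_rep T \<in> T" "class_rep U \<in> U"
    using assms fdt_class_rep(1) by blast+
  show "(class_rep T, class_rep U) \<in> fdt_iso G TG"
    using assms fdt_class_rep(2) by (simp add: fdt_iso_def)
qed

lemma fdt_class_of:
  assumes "fdt_gset G TG P"
  shows "fdt_iso G TG `` {P} \<in> fdt_classes G TG"
    "gset_iso G P (class_rep (fdt_iso G TG `` {P}))"
proof -
  show *: "fdt_iso G TG `` {P} \<in> fdt_classes G TG"
    using assms by (auto simp: fdt_classes_def intro: quotientI)
  show "gset_iso G P (class_rep (fdt_iso G TG `` {P}))"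
    using fdt_class_rep(1)[OF *] by (auto simp: fdt_iso_def)
qed

text \<open>The quotient of a transitive \<open>G\<close>-set by a stable equivalence relation.  With a base point \<open>x0\<close>, the
  class of \<open>y\<close> is represented by the set of all \<open>h\<close> in \<open>G\<close> that carry \<open>x0\<close> into that class.  This is a
  coset of an open subgroup, so the points of the quotient are again subsets of \<open>G\<close>, and the
  construction does not leave the type over which isomorphism classes are formed.\<close>

lemma quotient_gset:
  fixes P :: "('a, 'x) gset"
  assumes P: "fdt_gset G TG P" and r: "equiv (fst P) r"
    and stable: "\<And>g s t. g \<in> carrier G \<Longrightarrow> (s, t) \<in> r \<Longrightarrow> (snd P g s, snd P g t) \<in> r"
  shows "\<exists>Q :: ('a, 'a set) gset. fdt_gset G TG Q \<and>
           (\<exists>p\<in>gmaps G P Q. \<forall>s\<in>fst P. \<forall>t\<in>fst P. p s = p t \<longleftrightarrow> (s, t) \<in> r)"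
proof -
  obtain x0 where x0: "x0 \<in> fst P" using fdt_nonempty[OF P] by blast
  define p where "p = (\<lambda>y\<in>fst P. {h \<in> carrier G. (snd P h x0, y) \<in> r})"
  note rD = equivE[OF r]
  have p_iff: "p s = p t \<longleftrightarrow> (s, t) \<in> r" if s: "s \<in> fst P" and t: "t \<in> fst P" for s t
  proof
    assume eq: "p s = p t"
    obtain h where "h \<in> carrier G" "snd P h x0 = s" using fdt_transitive[OF P x0 s] by blast
    moreover have "(s, s) \<in> r" using r s by (auto simp: equiv_def refl_on_def)
    ultimately have "h \<in> p s" using s by (simp add: p_def)
    then show "(s, t) \<in> r" using eq t \<open>snd P h x0 = s\<close> by (simp add: p_def)
  next
    assume "(s, t) \<in> r"
    then show "p s = p t"
      using s t equiv_class_eq_iff[OF r] by (auto simp: p_def)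
  qed
  define E where "E = p ` fst P"
  define b where "b g = (\<lambda>C\<in>E. p (snd P g (inv_into (fst P) p C)))" for g
  have b: "b g (p y) = p (snd P g y)" if g: "g \<in> carrier G" and y: "y \<in> fst P" for g y
  proof -
    have "inv_into (fst P) p (p y) \<in> fst P" "p (inv_into (fst P) p (p y)) = p y"
      using y by (simp_all add: inv_into_into f_inv_into_f)
    then have "(snd P g (inv_into (fst P) p (p y)), snd P g y) \<in> r"
      using p_iff y stable g by blast
    then show ?thesis
      using p_iff fdt_closed[OF P g] y \<open>inv_into (fst P) p (p y) \<in> fst P\<close> by (simp add: b_def E_def)
  qed
  have "fdt_gset G TG (E, b)"
  proof (rule fdt_gsetI)
    show "finite E" "E \<noteq> {}" using fdt_finite[OF P] x0 by (auto simp: E_def)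
    show "b g \<in> extensional E" for g by (simp add: b_def)
    show "b g C \<in> E" if "g \<in> carrier G" "C \<in> E" for g C
      using that b fdt_closed[OF P] by (auto simp: E_def)
    show "b \<one> C = C" if "C \<in> E" for C
      using that b fdt_one[OF P] by (auto simp: E_def)
    show "b (g \<otimes> h) C = b g (b h C)" if "g \<in> carrier G" "h \<in> carrier G" "C \<in> E" for g h C
      using that b fdt_mult[OF P] fdt_closed[OF P] by (auto simp: E_def)
    show "\<exists>g\<in>carrier G. b g C = D" if CD: "C \<in> E" "D \<in> E" for C D
    proof -
      obtain x y where "x \<in> fst P" "C = p x" "y \<in> fst P" "D = p y" using CD by (auto simp: E_def)
      moreover obtain g where "g \<in> carrier G" "snd P g x = y"
        using fdt_transitive[OF P] calculation by blast
      ultimately show ?thesis using b[of g x] by auto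
    qed
    show "openin TG {g \<in> carrier G. b g C = D}" if CD: "C \<in> E" "D \<in> E" for C D
    proof -
      obtain x y where xy: "x \<in> fst P" "C = p x" "y \<in> fst P" "D = p y" using CD by (auto simp: E_def)
      have "b g C = D \<longleftrightarrow> (snd P g x, y) \<in> r" if "g \<in> carrier G" for g
        using xy b that p_iff fdt_closed[OF P] by simp
      then have "{g \<in> carrier G. b g C = D} = (\<Union>z\<in>{z \<in> fst P. (z, y) \<in> r}. {g \<in> carrier G. snd P g x = z})"
        using xy fdt_closed[OF P] by auto
      also have "openin TG \<dots>" using xy fdt_open[OF P] by (intro openin_Union) auto
      finally show ?thesis .
    qed
  qed
  moreover have "p \<in> gmaps G P (E, b)"
    by (rule gmapsI) (auto simp: b E_def, simp add: p_def)
  ultimately show ?thesis using p_iff by blast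
qed

text \<open>The quotient is replaced by the chosen representative of its isomorphism class, with the same
  fibres of the projection.\<close>

lemma class_quotient:
  assumes T: "T \<in> fdt_classes G TG" and r: "equiv (fst (class_rep T)) r"
    and stable: "\<And>g s t. g \<in> carrier G \<Longrightarrow> (s, t) \<in> r \<Longrightarrow> (snd (class_rep T) g s, snd (class_rep T) g t) \<in> r"
  shows "\<exists>V\<in>fdt_classes G TG. \<exists>p\<in>gmaps G (class_rep T) (class_rep V).
           \<forall>s\<in>fst (class_rep T). \<forall>t\<in>fst (class_rep T). p s = p t \<longleftrightarrow> (s, t) \<in> r"
proof -
  let ?P = "class_rep T"
  have P: "fdt_gset G TG ?P" using fdt_class_rep T by blast
  obtain Q :: "('a, 'a set) gset" and p where Q: "fdt_gset G TG Q" and p: "p \<in> gmaps G ?P Q"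
    and p_iff: "\<forall>s\<in>fst ?P. \<forall>t\<in>fst ?P. p s = p t \<longleftrightarrow> (s, t) \<in> r"
    using quotient_gset[OF P r stable] by blast
  let ?V = "fdt_iso G TG `` {Q}"
  obtain f where f: "f \<in> gmaps G Q (class_rep ?V)" "bij_betw f (fst Q) (fst (class_rep ?V))"
    using fdt_class_of(2)[OF Q] by (auto simp: gset_iso_def)
  have "compose (fst ?P) f p s = compose (fst ?P) f p t \<longleftrightarrow> (s, t) \<in> r"
    if "s \<in> fst ?P" "t \<in> fst ?P" for s t
    using that p_iff gmapsD(2)[OF p] inj_on_eq_iff[OF bij_betw_imp_inj_on[OF f(2)]]
    by (simp add: compose_def)
  then show ?thesis
    using fdt_class_of(1)[OF Q] gmaps_compose[OF P p f(1)] by blast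
qed

lemma class_le_trans:
  assumes "T \<in> fdt_classes G TG" "class_le G V U" "class_le G U T"
  shows "class_le G V T"
  using assms gmaps_compose[OF fdt_class_rep(2)] unfolding class_le_def by blast

lemma class_le_refl: "T \<in> fdt_classes G TG \<Longrightarrow> class_le G T T"
  using gmaps_id[OF fdt_class_rep(2)] unfolding class_le_def by blast

lemma class_card_pos: "T \<in> fdt_classes G TG \<Longrightarrow> class_card T > 0"
  using fdt_finite[OF fdt_class_rep(2)] fdt_nonempty[OF fdt_class_rep(2)]
  by (simp add: class_card_def card_gt_0_iff)

lemma class_le_card_dvd:
  assumes "T \<in> fdt_classes G TG" "U \<in> fdt_classes G TG" "class_le G U T"
  shows "class_card U dvd class_card T"
proof -
  obtain f where f: "f \<in> gmaps G (class_rep T) (class_rep U)" using assms by (auto simp: class_le_def)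
  obtain y where y: "y \<in> fst (class_rep U)" using fdt_nonempty[OF fdt_class_rep(2)[OF assms(2)]] by blast
  show ?thesis
    unfolding class_card_def
    by (subst gmaps_fibre_card[OF fdt_class_rep(2)[OF assms(1)] fdt_class_rep(2)[OF assms(2)] f y, symmetric]) simp
qed

lemma class_le_card:
  "T \<in> fdt_classes G TG \<Longrightarrow> U \<in> fdt_classes G TG \<Longrightarrow> class_le G U T \<Longrightarrow> class_card U \<le> class_card T"
  by (intro dvd_imp_le class_le_card_dvd class_card_pos)

lemma class_le_card_eq:
  assumes T: "T \<in> fdt_classes G TG" and U: "U \<in> fdt_classes G TG" and le: "class_le G U T"
    and card: "class_card U = class_card T"
  shows "U = T"
proof -
  obtain f where f: "f \<in> gmaps G (class_rep T) (class_rep U)" using le by (auto simp: class_le_def)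
  have "f ` fst (class_rep T) = fst (class_rep U)"
    by (rule gmaps_surj[OF fdt_class_rep(2)[OF T] fdt_class_rep(2)[OF U] f])
  then have "bij_betw f (fst (class_rep T)) (fst (class_rep U))"
    using card fdt_finite[OF fdt_class_rep(2)[OF T]] by (simp add: bij_betw_def class_card_def eq_card_imp_inj_on)
  then show ?thesis
    using f fdt_classes_eqI[OF T U] by (auto simp: gset_iso_def)
qed

text \<open>A quotient of \<open>T\<close> is determined up to isomorphism by the equivalence relation \<open>f s = f t\<close> of a
  \<open>G\<close>-map \<open>f\<close>, and a finite set carries finitely many relations.\<close>

lemma finite_below:
  assumes T: "T \<in> fdt_classes G TG"
  shows "finite {U \<in> fdt_classes G TG. class_le G U T}"
proof -
  let ?D = "{U \<in> fdt_classes G TG. class_le G U T}" and ?P = "class_rep T"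
  have P: "fdt_gset G TG ?P" using fdt_class_rep T by blast
  define q where "q U = (SOME f. f \<in> gmaps G ?P (class_rep U))" for U
  define ker where "ker U = {(s, t). s \<in> fst ?P \<and> t \<in> fst ?P \<and> q U s = q U t}" for U
  have q: "q U \<in> gmaps G ?P (class_rep U)" if "U \<in> ?D" for U
    using that by (auto simp: q_def class_le_def some_in_eq)
  have le: "class_le G U' U" if U: "U \<in> ?D" and U': "U' \<in> ?D" and eq: "ker U = ker U'" for U U'
  proof -
    have *: "q U' s = q U' t" if "s \<in> fst ?P" "t \<in> fst ?P" "q U s = q U t" for s t
    proof -
      have "(s, t) \<in> ker U" using that by (simp add: ker_def)
      then show ?thesis unfolding eq by (simp add: ker_def)
    qed
    have "fdt_gset G TG (class_rep U)" using U fdt_class_rep(2) by blast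
    from gmaps_factor[OF P this q[OF U] q[OF U'] *]
    have "\<exists>h\<in>gmaps G (class_rep U) (class_rep U'). \<forall>x\<in>fst ?P. h (q U x) = q U' x" .
    then show ?thesis unfolding class_le_def by blast
  qed
  have "inj_on ker ?D"
  proof (rule inj_onI)
    fix U U' assume *: "U \<in> ?D" "U' \<in> ?D" "ker U = ker U'"
    have "class_le G U U'" "class_le G U' U"
      using le[OF *] le[OF *(2,1) *(3)[symmetric]] by blast+
    then have "class_card U = class_card U'"
      using * class_le_card[of U U'] class_le_card[of U' U] by simp
    then show "U = U'"
      using * class_le_card_eq[of U' U] \<open>class_le G U U'\<close> by simp
  qed
  moreover have "ker ` ?D \<subseteq> Pow (fst ?P \<times> fst ?P)" by (auto simp: ker_def)
  moreover have "finite (Pow (fst ?P \<times> fst ?P))" using fdt_finite[OF P] by simp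
  ultimately show ?thesis using finite_subset finite_imageD by blast
qed

end

context profinite_group
begin

text \<open>The cosets form a disjoint open cover of the group, so compactness makes their number finite.\<close>

lemma coset_gset_fdt:
  assumes H: "subgroup H G" and "open": "openin TG H"
  shows "fdt_gset G TG (coset_gset G H)"
proof -
  interpret subgroup H G by (rule H)
  have translate: "continuous_map TG TG (\<lambda>g. x \<otimes> g \<otimes> y)" if "x \<in> carrier G" "y \<in> carrier G" for x y
  proof -
    have *: "continuous_map TG TG (\<lambda>g. f g \<otimes> h g)" if "continuous_map TG TG f" "continuous_map TG TG h" for f h
    proof -
      have "continuous_map TG (prod_topology TG TG) (\<lambda>g. (f g, h g))"
        using that by (simp add: continuous_map_pairwise o_def)
      from continuous_map_compose[OF this continuous_mult] show ?thesis by (simp add: o_def)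
    qed
    show ?thesis
      by (intro *) (use that in \<open>auto simp: topspace_eq\<close>)
  qed
  have coset_eq: "x <# H = y <# H \<longleftrightarrow> inv y \<otimes> x \<in> H" if x: "x \<in> carrier G" and y: "y \<in> carrier G" for x y
  proof
    assume "x <# H = y <# H"
    then have "x \<in> y <# H" using lcos_self[OF x H] by simp
    then show "inv y \<otimes> x \<in> H" using lcos_module_imp[OF is_group y] by simp
  next
    assume "inv y \<otimes> x \<in> H"
    then have "x \<in> y <# H" using lcos_module_rev[OF is_group y x] by simp
    then show "x <# H = y <# H" using l_repr_independence[OF _ y H] by simp
  qed
  have open_rel: "openin TG {g \<in> carrier G. (g \<otimes> x) <# H = y <# H}" if "x \<in> carrier G" "y \<in> carrier G" for x y
  proof -
    have "{g \<in> carrier G. (g \<otimes> x) <# H = y <# H} = {g \<in> topspace TG. inv y \<otimes> g \<otimes> x \<in> H}"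
      unfolding topspace_eq using that by (intro Collect_cong conj_cong) (simp_all add: coset_eq m_assoc)
    then show ?thesis
      using openin_continuous_map_preimage[OF translate[of "inv y" x] "open"] that by simp
  qed
  have cosets: "lcosets H = (\<lambda>x. x <# H) ` carrier G" by (auto simp: LCOSETS_def)
  have "openin TG C" if C: "C \<in> lcosets H" for C
  proof -
    obtain y where y: "y \<in> carrier G" "C = y <# H" using C cosets by auto
    have "g \<in> C \<longleftrightarrow> g \<in> carrier G \<and> (g \<otimes> \<one>) <# H = y <# H" for g
    proof (cases "g \<in> carrier G")
      case True
      then show ?thesis
        using coset_eq[OF True y(1)] lcos_module_imp[OF is_group y(1), of g]
          lcos_module_rev[OF is_group y(1) True] unfolding y(2) by (simp only: r_one) blast
    next
      case False
      then show ?thesis using l_coset_subset_G[OF subset y(1)] y(2) by blast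
    qed
    then have "C = {g \<in> carrier G. (g \<otimes> \<one>) <# H = y <# H}" by blast
    then show ?thesis using open_rel[of \<one> y] y by simp
  qed
  then have "\<exists>\<F>. finite \<F> \<and> \<F> \<subseteq> lcosets H \<and> \<Union>\<F> = topspace TG"
    using compact[unfolded compact_space, rule_format, of "lcosets H"] lcosets_part_G[OF H]
    by (simp add: topspace_eq)
  then obtain \<F> where \<F>: "finite \<F>" "\<F> \<subseteq> lcosets H" "carrier G \<subseteq> \<Union>\<F>"
    by (auto simp: topspace_eq)
  have "lcosets H \<subseteq> \<F>"
  proof
    fix C assume C: "C \<in> lcosets H"
    then obtain y where y: "y \<in> carrier G" "C = y <# H" using cosets by auto
    then have "y \<in> C" using lcos_self H by blast
    moreover obtain D where "D \<in> \<F>" "y \<in> D" using y \<F> by auto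
    ultimately show "C \<in> \<F>" using lcos_disjoint[OF H C, of D] \<F>(2) by blast
  qed
  then have fin: "finite (lcosets H)" using \<F> finite_subset by blast
  have act: "g <# (x <# H) = (g \<otimes> x) <# H" if "g \<in> carrier G" "x \<in> carrier G" for g x
    using that by (simp add: lcos_m_assoc subset)
  show ?thesis
    unfolding coset_gset_def
  proof (rule fdt_gsetI)
    show "finite (lcosets H)" by (rule fin)
    show "lcosets H \<noteq> {}" using cosets by auto
    show "(\<lambda>C\<in>lcosets H. g <# C) C \<in> lcosets H" if "g \<in> carrier G" "C \<in> lcosets H" for g C
      using that act by (auto simp: cosets)
    show "(\<lambda>C\<in>lcosets H. \<one> <# C) C = C" if "C \<in> lcosets H" for C
      using that act by (auto simp: cosets)
    show "(\<lambda>C\<in>lcosets H. (g \<otimes> h) <# C) C = (\<lambda>C\<in>lcosets H. g <# C) ((\<lambda>C\<in>lcosets H. h <# C) C)"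
      if "g \<in> carrier G" "h \<in> carrier G" "C \<in> lcosets H" for g h C
      using that act by (auto simp: cosets m_assoc)
    show "\<exists>g\<in>carrier G. (\<lambda>C\<in>lcosets H. g <# C) C = D" if CD: "C \<in> lcosets H" "D \<in> lcosets H" for C D
    proof -
      obtain x y where xy: "x \<in> carrier G" "C = x <# H" "y \<in> carrier G" "D = y <# H" using CD cosets by auto
      then have "(y \<otimes> inv x) <# C = D" using act[of "y \<otimes> inv x" x] by (simp add: m_assoc)
      then show ?thesis using xy CD by (intro bexI[of _ "y \<otimes> inv x"]) auto
    qed
    show "openin TG {g \<in> carrier G. (\<lambda>C\<in>lcosets H. g <# C) C = D}" if CD: "C \<in> lcosets H" "D \<in> lcosets H" for C D
    proof -
      obtain x y where xy: "x \<in> carrier G" "C = x <# H" "y \<in> carrier G" "D = y <# H" using CD cosets by auto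
      then have "{g \<in> carrier G. (\<lambda>C\<in>lcosets H. g <# C) C = D} = {g \<in> carrier G. (g \<otimes> x) <# H = y <# H}"
        using CD(1) act by (intro Collect_cong conj_cong) simp_all
      then show ?thesis using open_rel xy by simp
    qed
  qed simp
qed

lemma quot_class:
  assumes "subgroup H G" "openin TG H"
  shows "quot_class G TG H \<in> fdt_classes G TG"
    "gset_iso G (coset_gset G H) (class_rep (quot_class G TG H))"
  unfolding quot_class_def using fdt_class_of[OF coset_gset_fdt[OF assms]] by auto

end

section \<open>Coloured maps and the Burnside congruence\<close>

definition orbit_rel :: "('g, 'x) gset \<Rightarrow> ('x \<Rightarrow> 'x) \<Rightarrow> 'x rel" where
  "orbit_rel P s = {(x, y). x \<in> fst P \<and> y \<in> fst P \<and> (\<exists>k. (s ^^ k) x = y)}"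

text \<open>A coloured map is a \<open>G\<close>-map \<open>h\<close> to a fixed \<open>G\<close>-set together with a colouring \<open>d\<close> of its fibre over
  a fixed point \<open>u\<close>.  Such pairs are pulled back along a \<open>G\<close>-map \<open>p\<close>.\<close>

definition pullback :: "('g, 'x) gset \<Rightarrow> 'y \<Rightarrow> ('x \<Rightarrow> 'z) \<Rightarrow> ('z \<Rightarrow> 'y) \<times> ('z \<Rightarrow> nat) \<Rightarrow> ('x \<Rightarrow> 'y) \<times> ('x \<Rightarrow> nat)" where
  "pullback P u p = (\<lambda>(h, d). (compose (fst P) h p, \<lambda>t\<in>{t \<in> fst P. h (p t) = u}. d (p t)))"

text \<open>If the colour \<open>i\<close> stands for the monomial \<open>\<mu> i\<close>, then the weights of the colourings of a fibre with
  \<open>n\<close> points add up to the \<open>n\<close>-th power of the sum of these monomials.\<close>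

definition weight :: "('g, 'x) gset \<Rightarrow> 'y \<Rightarrow> (nat \<Rightarrow> 'm::comm_monoid_add) \<Rightarrow> ('x \<Rightarrow> 'y) \<times> ('x \<Rightarrow> nat) \<Rightarrow> ('m \<Rightarrow>\<^sub>0 int)" where
  "weight P u \<mu> = (\<lambda>(f, c). \<Prod>t\<in>{t \<in> fst P. f t = u}. frag_of (\<mu> (c t)))"

context topological_group_on
begin

lemma gmaps_endo_bij:
  assumes P: "fdt_gset G TG P" and s: "s \<in> gmaps G P P"
  shows "bij_betw s (fst P) (fst P)"
  using gmaps_surj[OF P P s] finite_surj_inj[OF fdt_finite[OF P], of s] by (simp add: bij_betw_def)

lemma gmaps_endo_funpow:
  assumes P: "fdt_gset G TG P" and s: "s \<in> gmaps G P P" and x: "x \<in> fst P"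
  shows "(s ^^ k) x \<in> fst P"
    and "g \<in> carrier G \<Longrightarrow> (s ^^ k) (snd P g x) = snd P g ((s ^^ k) x)"
proof -
  show *: "(s ^^ k) x \<in> fst P" for k
    using x gmapsD(2)[OF s] by (induction k) auto
  show "(s ^^ k) (snd P g x) = snd P g ((s ^^ k) x)" if g: "g \<in> carrier G"
    by (induction k) (simp_all add: gmapsD(3)[OF s g *])
qed

text \<open>Symmetry: if \<open>y\<close> is reached from \<open>x\<close>, then the orbit of \<open>y\<close> is contained in that of \<open>x\<close> and is its
  image under a power of the bijection \<open>s\<close>.  Both orbits are finite, so they coincide.\<close>

lemma orbit_rel_equiv:
  assumes P: "fdt_gset G TG P" and s: "s \<in> gmaps G P P"
  shows "equiv (fst P) (orbit_rel P s)"
proof (rule equivI)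
  show "orbit_rel P s \<subseteq> fst P \<times> fst P" by (auto simp: orbit_rel_def)
  show "refl_on (fst P) (orbit_rel P s)"
    unfolding refl_on_def orbit_rel_def by (auto intro: exI[of _ 0])
  show "trans (orbit_rel P s)"
  proof (rule transI)
    fix x y z assume "(x, y) \<in> orbit_rel P s" "(y, z) \<in> orbit_rel P s"
    then obtain k l where "x \<in> fst P" "z \<in> fst P" "(s ^^ k) x = y" "(s ^^ l) y = z"
      by (auto simp: orbit_rel_def)
    moreover from this have "(s ^^ (l + k)) x = z" by (simp add: funpow_add)
    ultimately show "(x, z) \<in> orbit_rel P s" unfolding orbit_rel_def by blast
  qed
  show "sym (orbit_rel P s)"
  proof (rule symI)
    fix x y assume "(x, y) \<in> orbit_rel P s"
    then obtain k where x: "x \<in> fst P" and y: "y \<in> fst P" and k: "(s ^^ k) x = y"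
      by (auto simp: orbit_rel_def)
    define Orb where "Orb z = range (\<lambda>i. (s ^^ i) z)" for z
    have sub: "Orb x \<subseteq> fst P" using gmaps_endo_funpow(1)[OF P s x] by (auto simp: Orb_def)
    then have fin: "finite (Orb x)" using fdt_finite[OF P] finite_subset by blast
    have "Orb y = (s ^^ k) ` Orb x"
    proof -
      have "(s ^^ i) y = (s ^^ k) ((s ^^ i) x)" for i
        using k by (metis add.commute comp_apply funpow_add)
      then show ?thesis by (simp add: Orb_def image_image)
    qed
    moreover have "inj_on (s ^^ k) (fst P)"
      using bij_betw_funpow[OF gmaps_endo_bij[OF P s]] by (auto simp: bij_betw_def)
    ultimately have "card (Orb y) = card (Orb x)"
      using sub by (simp add: card_image inj_on_subset)
    moreover have "Orb y \<subseteq> Orb x"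
    proof -
      have "(s ^^ i) y = (s ^^ (i + k)) x" for i using k by (simp add: funpow_add)
      then show ?thesis unfolding Orb_def by auto
    qed
    ultimately have "Orb y = Orb x" using fin by (simp add: card_subset_eq)
    moreover have "x \<in> Orb x" unfolding Orb_def by (rule range_eqI[of _ _ 0]) simp
    ultimately obtain i where "x = (s ^^ i) y" unfolding Orb_def by auto
    then show "(y, x) \<in> orbit_rel P s" using x y by (auto simp: orbit_rel_def)
  qed
qed

lemma orbit_rel_stable:
  assumes "fdt_gset G TG P" "s \<in> gmaps G P P" "g \<in> carrier G" "(x, y) \<in> orbit_rel P s"
  shows "(snd P g x, snd P g y) \<in> orbit_rel P s"
  using assms gmaps_endo_funpow(2)[OF assms(1,2)] fdt_closed[OF assms(1,3)]
  by (auto simp: orbit_rel_def)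

definition coloured_maps :: "('a, 'x) gset \<Rightarrow> ('a, 'y) gset \<Rightarrow> 'y \<Rightarrow> nat \<Rightarrow> (('x \<Rightarrow> 'y) \<times> ('x \<Rightarrow> nat)) set" where
  "coloured_maps P U u k = (SIGMA f:gmaps G P U. {t \<in> fst P. f t = u} \<rightarrow>\<^sub>E {..<k})"

lemma finite_coloured_maps:
  assumes "finite (fst P)" "finite (fst U)"
  shows "finite (coloured_maps P U u k)"
  unfolding coloured_maps_def using assms by (auto intro!: finite_SigmaI gmaps_finite finite_PiE)

lemma pullback_coloured_maps:
  assumes P: "fdt_gset G TG P" and p: "p \<in> gmaps G P V" and z: "z \<in> coloured_maps V U u k"
  shows "pullback P u p z \<in> coloured_maps P U u k"
proof -
  obtain h d where z: "z = (h, d)" "h \<in> gmaps G V U" "d \<in> {v \<in> fst V. h v = u} \<rightarrow>\<^sub>E {..<k}"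
    using z by (auto simp: coloured_maps_def)
  have "compose (fst P) h p \<in> gmaps G P U" by (rule gmaps_compose[OF P p z(2)])
  moreover have "d (p t) \<in> {..<k}" if "t \<in> fst P" "h (p t) = u" for t
    using z(3) gmapsD(2)[OF p that(1)] that(2) by (auto simp: PiE_def Pi_def)
  ultimately show ?thesis
    by (auto simp: z(1) coloured_maps_def pullback_def compose_def restrict_def PiE_def extensional_def)
qed

lemma pullback_comp:
  assumes p: "p \<in> gmaps G P V" and q: "q \<in> gmaps G V W"
  shows "pullback P u (compose (fst P) q p) z = pullback P u p (pullback V u q z)"
  using gmapsD(2)[OF p]
  by (cases z) (auto simp: pullback_def compose_def restrict_def fun_eq_iff)

lemma pullback_id:
  assumes "z \<in> coloured_maps P U u k"
  shows "pullback P u (\<lambda>x\<in>fst P. x) z = z"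
proof -
  obtain f c where z: "z = (f, c)" "f \<in> gmaps G P U" "c \<in> {t \<in> fst P. f t = u} \<rightarrow>\<^sub>E {..<k}"
    using assms by (auto simp: coloured_maps_def)
  have "f \<in> extensional (fst P)" "c \<in> extensional {t \<in> fst P. f t = u}"
    using z(3) gmapsD(1)[OF z(2)] by (auto simp: PiE_def)
  then show ?thesis
    by (auto simp: z(1) pullback_def compose_def restrict_def fun_eq_iff extensional_def)
qed

text \<open>The points of the fibre over \<open>u\<close> are grouped along \<open>p\<close>, all of whose fibres have the same size.\<close>

lemma weight_pullback:
  assumes P: "fdt_gset G TG P" and V: "fdt_gset G TG V" and p: "p \<in> gmaps G P V"
  shows "weight P u \<mu> (pullback P u p (h, d))
       = (\<Prod>v\<in>{v \<in> fst V. h v = u}. frag_of (\<mu> (d v)) ^ (card (fst P) div card (fst V)))"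
proof -
  let ?o = "card (fst P) div card (fst V)"
  have "weight P u \<mu> (pullback P u p (h, d)) = (\<Prod>t\<in>{t \<in> fst P. h (p t) = u}. frag_of (\<mu> (d (p t))))"
    by (auto simp: weight_def pullback_def compose_def intro!: prod.cong)
  also have "\<dots> = (\<Prod>v\<in>{v \<in> fst V. h v = u}.
      \<Prod>t\<in>{t \<in> {t \<in> fst P. h (p t) = u}. p t = v}. frag_of (\<mu> (d (p t))))"
    using gmapsD(2)[OF p] fdt_finite[OF P] fdt_finite[OF V] by (intro prod.group[symmetric]) auto
  also have "\<dots> = (\<Prod>v\<in>{v \<in> fst V. h v = u}. frag_of (\<mu> (d v)) ^ ?o)"
  proof (rule prod.cong)
    fix v assume v: "v \<in> {v \<in> fst V. h v = u}"
    then have "card {t \<in> fst P. p t = v} * card (fst V) = card (fst P)"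
      using gmaps_fibre_card[OF P V p] by simp
    then have "card {t \<in> fst P. p t = v} = ?o"
      using fdt_finite[OF V] fdt_nonempty[OF V] by (metis card_gt_0_iff nonzero_mult_div_cancel_right not_gr_zero)
    moreover have "{t \<in> {t \<in> fst P. h (p t) = u}. p t = v} = {t \<in> fst P. p t = v}" using v by auto
    ultimately show "(\<Prod>t\<in>{t \<in> {t \<in> fst P. h (p t) = u}. p t = v}. frag_of (\<mu> (d (p t)))) = frag_of (\<mu> (d v)) ^ ?o"
      by simp
  qed simp
  finally show ?thesis .
qed

text \<open>Let \<open>V\<close> be the quotient of \<open>P\<close> by the orbits of an endomorphism \<open>s\<close>.  A coloured map is fixed by
  \<open>s\<close> if and only if both components are constant on these orbits, that is, if it is pulled back from
  \<open>V\<close>.  Each point of \<open>V\<close> stands for \<open>card P / card V\<close> points of \<open>P\<close> of the same colour, and this turns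
  the sum of monomials into its image under an Adams operation.\<close>

lemma sum_weight_fixed:
  assumes P: "fdt_gset G TG P" and V: "fdt_gset G TG V" and U: "fdt_gset G TG U"
    and s: "s \<in> gmaps G P P" and p: "p \<in> gmaps G P V"
    and ker: "\<And>x y. x \<in> fst P \<Longrightarrow> y \<in> fst P \<Longrightarrow> p x = p y \<longleftrightarrow> (x, y) \<in> orbit_rel P s"
    and u: "u \<in> fst U"
  shows "(\<Sum>z\<in>{z \<in> coloured_maps P U u k. pullback P u s z = z}. weight P u \<mu> z)
       = of_nat (card (gmaps G V U)) *
         adams (card (fst P) div card (fst V)) (\<Sum>i<k. frag_of (\<mu> i)) ^ (card (fst V) div card (fst U))"
proof -
  let ?o = "card (fst P) div card (fst V)"
  have surj: "p ` fst P = fst V" using gmaps_surj[OF P V p] .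
  have ps: "compose (fst P) p s = p"
  proof (rule extensionalityI)
    show "compose (fst P) p s x = p x" if x: "x \<in> fst P" for x
    proof -
      have "(x, s x) \<in> orbit_rel P s"
        using x gmapsD(2)[OF s x] by (auto simp: orbit_rel_def intro: exI[of _ 1])
      then show ?thesis using ker[OF x gmapsD(2)[OF s x]] x by (simp add: compose_def)
    qed
  qed (use gmapsD(1)[OF p] in \<open>auto simp: compose_def\<close>)
  \<comment> \<open>The coloured maps fixed by \<open>s\<close> are exactly the pullbacks from \<open>V\<close>.\<close>
  have "bij_betw (pullback P u p) (coloured_maps V U u k) {z \<in> coloured_maps P U u k. pullback P u s z = z}"
    unfolding bij_betw_def
  proof
    show "inj_on (pullback P u p) (coloured_maps V U u k)"
    proof (rule inj_onI, clarify)
      fix h d h' d'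
      assume z: "(h, d) \<in> coloured_maps V U u k" "(h', d') \<in> coloured_maps V U u k"
        and eq: "pullback P u p (h, d) = pullback P u p (h', d')"
      have h: "h \<in> gmaps G V U" "h' \<in> gmaps G V U" using z by (auto simp: coloured_maps_def)
      have hp: "h (p t) = h' (p t)" if t: "t \<in> fst P" for t
      proof -
        have "compose (fst P) h p t = compose (fst P) h' p t" using eq by (simp add: pullback_def)
        then show ?thesis using t by (simp add: compose_def)
      qed
      have hh: "h = h'"
        by (rule extensionalityI[OF gmapsD(1)[OF h(1)] gmapsD(1)[OF h(2)]]) (use hp surj in force)
      have "d (p t) = d' (p t)" if t: "t \<in> fst P" "h (p t) = u" for t
      proof -
        have "(\<lambda>t\<in>{t \<in> fst P. h (p t) = u}. d (p t)) t = (\<lambda>t\<in>{t \<in> fst P. h' (p t) = u}. d' (p t)) t"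
          using eq by (simp add: pullback_def)
        then show ?thesis using t hh by simp
      qed
      then have "d v = d' v" if "v \<in> {v \<in> fst V. h v = u}" for v using that surj by force
      then have "d = d'"
        using z hh by (intro extensionalityI[of d "{v \<in> fst V. h v = u}"]) (auto simp: coloured_maps_def PiE_def)
      then show "h = h' \<and> d = d'" using hh by simp
    qed
    show "pullback P u p ` coloured_maps V U u k = {z \<in> coloured_maps P U u k. pullback P u s z = z}"
    proof (intro equalityI subsetI)
      fix z assume "z \<in> pullback P u p ` coloured_maps V U u k"
      then obtain y where y: "y \<in> coloured_maps V U u k" "z = pullback P u p y" by blast
      then have "pullback P u s z = z"
        using pullback_comp[OF s p, of u y] ps by simp
      then show "z \<in> {z \<in> coloured_maps P U u k. pullback P u s z = z}"
        using pullback_coloured_maps[OF P p y(1)] y(2) by simp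
    next
      fix z assume "z \<in> {z \<in> coloured_maps P U u k. pullback P u s z = z}"
      then obtain f c where z: "z = (f, c)" and f: "f \<in> gmaps G P U"
        and c: "c \<in> {t \<in> fst P. f t = u} \<rightarrow>\<^sub>E {..<k}" and fix1: "compose (fst P) f s = f"
        and fix2: "(\<lambda>t\<in>{t \<in> fst P. f (s t) = u}. c (s t)) = c"
        by (auto simp: coloured_maps_def pullback_def)
      have fs: "f (s t) = f t" if "t \<in> fst P" for t using fun_cong[OF fix1, of t] that by (simp add: compose_def)
      have cs: "c (s t) = c t" if "t \<in> fst P" "f t = u" for t using fun_cong[OF fix2, of t] that fs by simp
      have "f ((s ^^ i) t) = f t \<and> (f t = u \<longrightarrow> c ((s ^^ i) t) = c t)" if t: "t \<in> fst P" for t i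
        using fs cs gmaps_endo_funpow(1)[OF P s t] by (induction i) auto
      then have const: "f x = f y \<and> (f x = u \<longrightarrow> c x = c y)" if "x \<in> fst P" "y \<in> fst P" "p x = p y" for x y
        using ker[OF that(1,2)] that by (auto simp: orbit_rel_def)
      obtain h where h: "h \<in> gmaps G V U" "\<forall>x\<in>fst P. h (p x) = f x"
        using gmaps_factor[OF P V p f] const by blast
      define d where "d = (\<lambda>v\<in>{v \<in> fst V. h v = u}. c (inv_into (fst P) p v))"
      have inv: "inv_into (fst P) p v \<in> fst P" "p (inv_into (fst P) p v) = v" if "v \<in> fst V" for v
        using that surj by (auto simp: inv_into_into f_inv_into_f)
      have d: "d (p t) = c t" if t: "t \<in> fst P" "f t = u" for t
      proof -
        have v: "p t \<in> fst V" using gmapsD(2)[OF p t(1)] .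
        have "h (p t) = u" using h t by simp
        then have "d (p t) = c (inv_into (fst P) p (p t))" using v by (simp add: d_def)
        moreover have "f (inv_into (fst P) p (p t)) = f t" using const[OF inv(1)[OF v] t(1)] inv(2)[OF v] by simp
        ultimately show ?thesis using const[OF inv(1)[OF v] t(1)] inv(2)[OF v] t(2) by simp
      qed
      have "d \<in> {v \<in> fst V. h v = u} \<rightarrow>\<^sub>E {..<k}"
      proof (rule PiE_I)
        fix v assume v: "v \<in> {v \<in> fst V. h v = u}"
        then obtain t where "t \<in> fst P" "v = p t" using surj by blast
        then show "d v \<in> {..<k}" using d[of t] h v c by (auto simp: PiE_def Pi_def)
      qed (auto simp: d_def)
      then have "(h, d) \<in> coloured_maps V U u k" using h by (simp add: coloured_maps_def)
      moreover have "pullback P u p (h, d) = (f, c)"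
      proof -
        have "compose (fst P) h p = f"
          by (rule extensionalityI[OF _ gmapsD(1)[OF f]]) (use h in \<open>auto simp: compose_def\<close>)
        moreover have "{t \<in> fst P. h (p t) = u} = {t \<in> fst P. f t = u}" using h by auto
        moreover have "(\<lambda>t\<in>{t \<in> fst P. f t = u}. d (p t)) = c"
          by (rule extensionalityI[of _ "{t \<in> fst P. f t = u}"]) (use c d in \<open>auto simp: PiE_def\<close>)
        ultimately show ?thesis by (simp add: pullback_def)
      qed
      ultimately show "z \<in> pullback P u p ` coloured_maps V U u k" unfolding z by force
    qed
  qed
  then have "(\<Sum>z\<in>{z \<in> coloured_maps P U u k. pullback P u s z = z}. weight P u \<mu> z)
      = (\<Sum>y\<in>coloured_maps V U u k. weight P u \<mu> (pullback P u p y))"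
    by (rule sum.reindex_bij_betw[symmetric])
  also have "\<dots> = (\<Sum>(h, d)\<in>coloured_maps V U u k. \<Prod>v\<in>{v \<in> fst V. h v = u}. frag_of (\<mu> (d v)) ^ ?o)"
    by (intro sum.cong) (auto simp: weight_pullback[OF P V p])
  also have "\<dots> = (\<Sum>h\<in>gmaps G V U. \<Sum>d\<in>{v \<in> fst V. h v = u} \<rightarrow>\<^sub>E {..<k}.
      \<Prod>v\<in>{v \<in> fst V. h v = u}. frag_of (\<mu> (d v)) ^ ?o)"
    unfolding coloured_maps_def
    using fdt_finite[OF V] fdt_finite[OF U] by (intro sum.Sigma[symmetric]) (auto intro!: gmaps_finite finite_PiE)
  also have "\<dots> = (\<Sum>h\<in>gmaps G V U. \<Prod>v\<in>{v \<in> fst V. h v = u}. \<Sum>i<k. frag_of (\<mu> i) ^ ?o)"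
    using fdt_finite[OF V] by (intro sum.cong prod_sum_PiE[symmetric]) auto
  also have "\<dots> = (\<Sum>h\<in>gmaps G V U. adams ?o (\<Sum>i<k. frag_of (\<mu> i)) ^ (card (fst V) div card (fst U)))"
  proof (rule sum.cong)
    fix h assume h: "h \<in> gmaps G V U"
    have "card {v \<in> fst V. h v = u} = card (fst V) div card (fst U)"
      using gmaps_fibre_card[OF V U h u] fdt_finite[OF U] fdt_nonempty[OF U]
      by (metis card_gt_0_iff nonzero_mult_div_cancel_right not_gr_zero)
    then show "(\<Prod>v\<in>{v \<in> fst V. h v = u}. \<Sum>i<k. frag_of (\<mu> i) ^ ?o)
        = adams ?o (\<Sum>i<k. frag_of (\<mu> i)) ^ (card (fst V) div card (fst U))"
      by (simp add: adams_sum)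
  qed simp
  finally show ?thesis by simp
qed

text \<open>Generalises the congruence \<open>(\<Sum>d dvd n. totient d * \<psi>\<^sup>d x ^ (n div d)) \<equiv> 0\<close> modulo \<open>n\<close>, which is the case where
  \<open>P\<close> is a regular cyclic \<open>G\<close>-set of order \<open>n\<close> and \<open>U\<close> is a point.  For a sum \<open>x\<close> of monomials it is the
  weighted Burnside lemma for the automorphisms of \<open>P\<close> acting on the coloured maps from \<open>P\<close> to \<open>U\<close>; a
  general \<open>x\<close> is congruent to such a sum.\<close>

lemma burnside_congruence:
  fixes x :: "'m::comm_monoid_add \<Rightarrow>\<^sub>0 int"
  assumes P: "fdt_gset G TG P" and U: "fdt_gset G TG U"
    and V: "\<And>s. s \<in> gmaps G P P \<Longrightarrow> fdt_gset G TG (V s)"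
    and p: "\<And>s. s \<in> gmaps G P P \<Longrightarrow> p s \<in> gmaps G P (V s)"
    and ker: "\<And>s x y. s \<in> gmaps G P P \<Longrightarrow> x \<in> fst P \<Longrightarrow> y \<in> fst P \<Longrightarrow>
                p s x = p s y \<longleftrightarrow> (x, y) \<in> orbit_rel P s"
  shows "of_nat (card (gmaps G P P)) dvd
           (\<Sum>s\<in>gmaps G P P. of_nat (card (gmaps G (V s) U)) *
              adams (card (fst P) div card (fst (V s))) x ^ (card (fst (V s)) div card (fst U)))"
proof -
  let ?N = "card (gmaps G P P)"
  let ?F = "\<lambda>y. \<Sum>s\<in>gmaps G P P. of_nat (card (gmaps G (V s) U)) *
      adams (card (fst P) div card (fst (V s))) y ^ (card (fst (V s)) div card (fst U))"
  have fin: "finite (gmaps G P P)" by (rule gmaps_finite[OF fdt_finite[OF P] fdt_finite[OF P]])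
  then have "?N > 0" using gmaps_id[OF P] card_gt_0_iff by blast
  then obtain \<mu> :: "nat \<Rightarrow> 'm" and k where \<mu>: "of_nat ?N dvd x - (\<Sum>i<k. frag_of (\<mu> i))"
    using monomial_sum_mod by blast
  obtain u where u: "u \<in> fst U" using fdt_nonempty[OF U] by blast
  have "of_nat ?N dvd (\<Sum>s\<in>gmaps G P P.
      \<Sum>z\<in>{z \<in> coloured_maps P U u k. pullback P u s z = z}. weight P u \<mu> z)"
    \<comment> \<open>Pulling back is contravariant, so the product of \<open>s\<close> and \<open>t\<close> is \<open>t \<circ> s\<close>.\<close>
  proof (rule weighted_burnside[where e = "\<lambda>x\<in>fst P. x" and op = "\<lambda>s t. compose (fst P) t s"])
    show "finite (coloured_maps P U u k)"
      by (rule finite_coloured_maps[OF fdt_finite[OF P] fdt_finite[OF U]])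
    show "pullback P u s z \<in> coloured_maps P U u k" if "s \<in> gmaps G P P" "z \<in> coloured_maps P U u k" for s z
      using pullback_coloured_maps[OF P that] .
    show "pullback P u (\<lambda>x\<in>fst P. x) z = z" if "z \<in> coloured_maps P U u k" for z
      using pullback_id[OF that] .
    show "compose (fst P) t s \<in> gmaps G P P" if "s \<in> gmaps G P P" "t \<in> gmaps G P P" for s t
      using gmaps_compose[OF P that] .
    show "pullback P u (compose (fst P) t s) z = pullback P u s (pullback P u t z)"
      if "s \<in> gmaps G P P" "t \<in> gmaps G P P" for s t z
      using pullback_comp[OF that] .
    show "inj_on (\<lambda>s. compose (fst P) t s) (gmaps G P P)" if t: "t \<in> gmaps G P P" for t
    proof (rule inj_onI)
      fix s s' assume s: "s \<in> gmaps G P P" "s' \<in> gmaps G P P" and eq: "compose (fst P) t s = compose (fst P) t s'"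
      show "s = s'"
      proof (rule extensionalityI[OF gmapsD(1)[OF s(1)] gmapsD(1)[OF s(2)]])
        fix x assume x: "x \<in> fst P"
        have "t (s x) = t (s' x)" using fun_cong[OF eq, of x] x by (simp add: compose_def)
        then show "s x = s' x"
          using inj_onD[OF bij_betw_imp_inj_on[OF gmaps_endo_bij[OF P t]]] gmapsD(2)[OF s(1) x] gmapsD(2)[OF s(2) x]
          by blast
      qed
    qed
    show "weight P u \<mu> (pullback P u s z) = weight P u \<mu> z" if s: "s \<in> gmaps G P P" for s z
    proof -
      obtain f c where z: "z = (f, c)" by (cases z)
      have "card (fst P) > 0" using fdt_finite[OF P] fdt_nonempty[OF P] by (simp add: card_gt_0_iff)
      then have "weight P u \<mu> (pullback P u s (f, c)) = (\<Prod>v\<in>{v \<in> fst P. f v = u}. frag_of (\<mu> (c v)))"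
        unfolding weight_pullback[OF P P s] by simp
      then show ?thesis by (simp add: z weight_def)
    qed
  qed (use fin gmaps_id[OF P] in auto)
  also have "(\<Sum>s\<in>gmaps G P P. \<Sum>z\<in>{z \<in> coloured_maps P U u k. pullback P u s z = z}. weight P u \<mu> z)
      = ?F (\<Sum>i<k. frag_of (\<mu> i))"
    by (intro sum.cong sum_weight_fixed[OF P V U _ p ker u]) auto
  finally have "of_nat ?N dvd ?F (\<Sum>i<k. frag_of (\<mu> i))" .
  moreover have "of_nat ?N dvd ?F x - ?F (\<Sum>i<k. frag_of (\<mu> i))"
    unfolding sum_subtractf[symmetric] right_diff_distrib[symmetric]
    by (intro dvd_sum dvd_mult dvd_diff_power adams_dvd \<mu>)
  ultimately have "of_nat ?N dvd (?F x - ?F (\<Sum>i<k. frag_of (\<mu> i))) + ?F (\<Sum>i<k. frag_of (\<mu> i))"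
    by (rule dvd_add[rotated])
  then show ?thesis by (simp only: diff_add_cancel)
qed

end

section \<open>Polynomials without constant term in given variables\<close>

lemma lookup_of_nat_mult:
  "Poly_Mapping.lookup (of_nat n * (p :: 'm::comm_monoid_add \<Rightarrow>\<^sub>0 int)) m = int n * Poly_Mapping.lookup p m"
  by (induction n) (simp_all add: algebra_simps lookup_add)

lemma of_nat_mult_cancel:
  fixes p q :: "'m::comm_monoid_add \<Rightarrow>\<^sub>0 int"
  assumes "of_nat n * p = of_nat n * q" "n > 0"
  shows "p = q"
proof (rule poly_mapping_eqI)
  fix m
  show "Poly_Mapping.lookup p m = Poly_Mapping.lookup q m"
    using arg_cong[OF assms(1), of "\<lambda>p. Poly_Mapping.lookup p m"] assms(2)
    by (simp add: lookup_of_nat_mult)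
qed

text \<open>The ideal generated by the variables in \<open>D\<close> inside the polynomials in these variables: no constant
  term, and no variable outside \<open>D\<close>.\<close>

definition poly_in :: "'v set \<Rightarrow> (('v \<Rightarrow>\<^sub>0 nat) \<Rightarrow>\<^sub>0 int) set" where
  "poly_in D = {p. \<forall>m\<in>Poly_Mapping.keys p. m \<noteq> 0 \<and> Poly_Mapping.keys m \<subseteq> D}"

lemma poly_in_zero [simp]: "0 \<in> poly_in D"
  by (simp add: poly_in_def)

lemma poly_in_mono: "p \<in> poly_in D \<Longrightarrow> D \<subseteq> D' \<Longrightarrow> p \<in> poly_in D'"
  unfolding poly_in_def by blast

lemma poly_in_add: "p \<in> poly_in D \<Longrightarrow> q \<in> poly_in D \<Longrightarrow> p + q \<in> poly_in D"
  using Poly_Mapping.keys_add[of p q] unfolding poly_in_def by blast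

lemma poly_in_diff: "p \<in> poly_in D \<Longrightarrow> q \<in> poly_in D \<Longrightarrow> p - q \<in> poly_in D"
  using keys_diff[of p q] unfolding poly_in_def by blast

lemma poly_in_sum: "(\<And>i. i \<in> I \<Longrightarrow> f i \<in> poly_in D) \<Longrightarrow> sum f I \<in> poly_in D"
  by (induction I rule: infinite_finite_induct) (simp_all add: poly_in_add)

lemma poly_in_mult:
  assumes "p \<in> poly_in D" "q \<in> poly_in D"
  shows "p * q \<in> poly_in D"
  unfolding poly_in_def
proof (intro CollectI ballI)
  fix m assume "m \<in> Poly_Mapping.keys (p * q)"
  then obtain a b where m: "m = a + b" and a: "a \<in> Poly_Mapping.keys p" and b: "b \<in> Poly_Mapping.keys q"
    using Poly_Mapping.keys_mult[of p q] by blast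
  have ab: "a \<noteq> 0" "Poly_Mapping.keys a \<subseteq> D" "Poly_Mapping.keys b \<subseteq> D"
    using a b assms by (auto simp: poly_in_def)
  then obtain v where "Poly_Mapping.lookup a v \<noteq> 0" by (metis poly_mapping_eqI lookup_zero)
  then have "Poly_Mapping.lookup m v \<noteq> 0" by (simp add: m lookup_add)
  then have "m \<noteq> 0" by auto
  then show "m \<noteq> 0 \<and> Poly_Mapping.keys m \<subseteq> D"
    using ab Poly_Mapping.keys_add[of a b] m by blast
qed

lemma poly_in_power:
  assumes "p \<in> poly_in D" "k > 0"
  shows "p ^ k \<in> poly_in D"
  using assms(2)
proof (induction k)
  case (Suc k)
  then show ?case using assms(1) by (cases "k = 0") (simp_all add: poly_in_mult)
qed simp

lemma poly_in_of_nat_mult: "p \<in> poly_in D \<Longrightarrow> of_nat n * p \<in> poly_in D"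
  unfolding poly_in_def by (auto simp: in_keys_iff lookup_of_nat_mult)

lemma poly_in_of_nat_mult_iff: "n > 0 \<Longrightarrow> of_nat n * p \<in> poly_in D \<longleftrightarrow> p \<in> poly_in D"
  unfolding poly_in_def by (auto simp: in_keys_iff lookup_of_nat_mult)

lemma poly_in_frag_of: "v \<in> D \<Longrightarrow> frag_of (Poly_Mapping.single v 1) \<in> poly_in D"
  unfolding poly_in_def by (auto dest: arg_cong[where f = "\<lambda>m. Poly_Mapping.lookup m v"])

lemma var_X_in: "Inl i \<in> D \<Longrightarrow> var_X i \<in> poly_in D"
  unfolding var_X_def by (rule poly_in_frag_of)

lemma var_Y_in: "Inr i \<in> D \<Longrightarrow> var_Y i \<in> poly_in D"
  unfolding var_Y_def by (rule poly_in_frag_of)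

section \<open>Integral solutions of the Witt equations\<close>

context topological_group_on
begin

abbreviation classes_below :: "'a gclass \<Rightarrow> 'a gclass set" where
  "classes_below T \<equiv> {U \<in> fdt_classes G TG. class_le G U T}"

abbreviation End :: "'a gclass \<Rightarrow> ('a set \<Rightarrow> 'a set) set" where
  "End T \<equiv> gmaps G (class_rep T) (class_rep T)"

lemma finite_End: "T \<in> fdt_classes G TG \<Longrightarrow> finite (End T)"
  by (intro gmaps_finite fdt_finite fdt_class_rep(2))

lemma num_gmaps_pos:
  assumes "T \<in> fdt_classes G TG"
  shows "num_gmaps G T T > 0"
  using finite_End[OF assms] gmaps_id[OF fdt_class_rep(2)[OF assms]]
  unfolding num_gmaps_def card_gt_0_iff by blast

lemma class_card_less:
  assumes "T \<in> fdt_classes G TG" "U \<in> classes_below T - {T}"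
  shows "class_card U < class_card T"
  using assms class_le_card[of T U] class_le_card_eq[of T U] by fastforce

lemma class_card_div_pos:
  assumes "T \<in> fdt_classes G TG" "U \<in> classes_below T"
  shows "class_card T div class_card U > 0"
  using assms class_le_card[of T U] class_card_pos[of U] by (simp add: div_greater_zero_iff)

lemma witt_poly_split:
  assumes T: "T \<in> fdt_classes G TG"
  shows "witt_poly G TG T x =
    (\<Sum>U\<in>classes_below T - {T}. of_nat (num_gmaps G T U) * x U ^ (class_card T div class_card U))
    + of_nat (num_gmaps G T T) * x T"
proof -
  have "T \<in> classes_below T" using T class_le_refl by blast
  then show ?thesis
    unfolding witt_poly_def
    using sum.remove[OF finite_below[OF T], of T
        "\<lambda>U. of_nat (num_gmaps G T U) * x U ^ (class_card T div class_card U)"] class_card_pos[OF T]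
    by (simp add: add.commute)
qed

text \<open>The class of the quotient of \<open>T\<close> by the orbits of an automorphism \<open>s\<close> of \<open>T\<close>.\<close>

definition orbit_class :: "'a gclass \<Rightarrow> ('a set \<Rightarrow> 'a set) \<Rightarrow> 'a gclass" where
  "orbit_class T s = (SOME V. V \<in> fdt_classes G TG \<and> (\<exists>p\<in>gmaps G (class_rep T) (class_rep V).
     \<forall>x\<in>fst (class_rep T). \<forall>y\<in>fst (class_rep T). p x = p y \<longleftrightarrow> (x, y) \<in> orbit_rel (class_rep T) s))"

lemma orbit_class:
  assumes T: "T \<in> fdt_classes G TG" and s: "s \<in> End T"
  shows "orbit_class T s \<in> fdt_classes G TG"
    and "\<exists>p\<in>gmaps G (class_rep T) (class_rep (orbit_class T s)).
      \<forall>x\<in>fst (class_rep T). \<forall>y\<in>fst (class_rep T). p x = p y \<longleftrightarrow> (x, y) \<in> orbit_rel (class_rep T) s"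
proof -
  have P: "fdt_gset G TG (class_rep T)" using fdt_class_rep(2)[OF T] .
  have "\<exists>V. V \<in> fdt_classes G TG \<and> (\<exists>p\<in>gmaps G (class_rep T) (class_rep V).
     \<forall>x\<in>fst (class_rep T). \<forall>y\<in>fst (class_rep T). p x = p y \<longleftrightarrow> (x, y) \<in> orbit_rel (class_rep T) s)"
    using class_quotient[OF T orbit_rel_equiv[OF P s] orbit_rel_stable[OF P s]] by blast
  from someI_ex[OF this] show "orbit_class T s \<in> fdt_classes G TG"
    and "\<exists>p\<in>gmaps G (class_rep T) (class_rep (orbit_class T s)).
      \<forall>x\<in>fst (class_rep T). \<forall>y\<in>fst (class_rep T). p x = p y \<longleftrightarrow> (x, y) \<in> orbit_rel (class_rep T) s"
    unfolding orbit_class_def by blast+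
qed

lemma orbit_class_le:
  assumes "T \<in> fdt_classes G TG" "s \<in> End T"
  shows "class_le G (orbit_class T s) T"
  using orbit_class(2)[OF assms] unfolding class_le_def by blast

lemma orbit_class_eq_iff:
  assumes T: "T \<in> fdt_classes G TG" and s: "s \<in> End T"
  shows "orbit_class T s = T \<longleftrightarrow> s = (\<lambda>x\<in>fst (class_rep T). x)"
proof -
  let ?P = "class_rep T" and ?V = "orbit_class T s"
  have P: "fdt_gset G TG ?P" and V: "fdt_gset G TG (class_rep ?V)"
    using fdt_class_rep(2) orbit_class(1)[OF T s] T by blast+
  obtain p where p: "p \<in> gmaps G ?P (class_rep ?V)"
    and ker: "\<And>x y. x \<in> fst ?P \<Longrightarrow> y \<in> fst ?P \<Longrightarrow> p x = p y \<longleftrightarrow> (x, y) \<in> orbit_rel ?P s"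
    using orbit_class(2)[OF T s] by blast
  have surj: "p ` fst ?P = fst (class_rep ?V)" by (rule gmaps_surj[OF P V p])
  show ?thesis
  proof
    assume eq: "?V = T"
    then have "p ` fst ?P = fst ?P" using surj by simp
    then have inj: "inj_on p (fst ?P)"
      using fdt_finite[OF P] by (simp add: eq_card_imp_inj_on)
    show "s = (\<lambda>x\<in>fst ?P. x)"
    proof (rule extensionalityI[OF gmapsD(1)[OF s]])
      fix x assume x: "x \<in> fst ?P"
      then have "(x, s x) \<in> orbit_rel ?P s"
        using gmapsD(2)[OF s x] by (auto simp: orbit_rel_def intro: exI[of _ 1])
      then have "p x = p (s x)" using ker[OF x gmapsD(2)[OF s x]] by blast
      then show "s x = (\<lambda>x\<in>fst ?P. x) x"
        using inj_onD[OF inj] x gmapsD(2)[OF s x] by simp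
    qed simp
  next
    assume s_id: "s = (\<lambda>x\<in>fst ?P. x)"
    have pow: "(s ^^ k) x = x" if "x \<in> fst ?P" for x k
      by (induction k) (use that s_id in auto)
    have "inj_on p (fst ?P)"
    proof (rule inj_onI)
      fix x y assume "x \<in> fst ?P" "y \<in> fst ?P" "p x = p y"
      then show "x = y" using ker[of x y] pow[of x] by (auto simp: orbit_rel_def)
    qed
    then have "class_card ?V = class_card T"
      using surj card_image unfolding class_card_def by metis
    then show "?V = T"
      using class_le_card_eq[OF T orbit_class(1)[OF T s] orbit_class_le[OF T s]] by simp
  qed
qed

text \<open>The congruences that hold for the values of all Witt polynomials at one family.  The Adams operations are
  ring homomorphisms, so the left side splits into one sum for each \<open>U \<le> T\<close>, to which the congruence for
  coloured maps applies.\<close>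

lemma ghost_congruence:
  fixes x :: "'a gclass \<Rightarrow> 'm::comm_monoid_add \<Rightarrow>\<^sub>0 int"
  assumes T: "T \<in> fdt_classes G TG"
  shows "of_nat (num_gmaps G T T) dvd
    (\<Sum>s\<in>End T. adams (class_card T div class_card (orbit_class T s)) (witt_poly G TG (orbit_class T s) x))"
proof -
  let ?V = "orbit_class T"
  let ?t = "\<lambda>U s. of_nat (num_gmaps G (?V s) U) *
      adams (class_card T div class_card (?V s)) (x U) ^ (class_card (?V s) div class_card U)"
  have "adams (class_card T div class_card (?V s)) (witt_poly G TG (?V s) x) = (\<Sum>U\<in>classes_below T. ?t U s)"
    if s: "s \<in> End T" for s
  proof -
    have V: "?V s \<in> fdt_classes G TG" "class_le G (?V s) T"
      using orbit_class(1)[OF T s] orbit_class_le[OF T s] .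
    have "adams (class_card T div class_card (?V s)) (witt_poly G TG (?V s) x) = (\<Sum>U\<in>classes_below (?V s). ?t U s)"
      unfolding witt_poly_def by (simp add: adams_sum adams_mult adams_power)
    also have "\<dots> = (\<Sum>U\<in>classes_below T. ?t U s)"
    proof (rule sum.mono_neutral_left[OF finite_below[OF T]])
      show "classes_below (?V s) \<subseteq> classes_below T" using class_le_trans[OF T _ V(2)] by blast
      show "\<forall>U\<in>classes_below T - classes_below (?V s). ?t U s = 0"
        by (auto simp: num_gmaps_def class_le_def)
    qed
    finally show ?thesis .
  qed
  then have "(\<Sum>s\<in>End T. adams (class_card T div class_card (?V s)) (witt_poly G TG (?V s) x))
      = (\<Sum>U\<in>classes_below T. \<Sum>s\<in>End T. ?t U s)"
    using sum.swap[of ?t "End T" "classes_below T"] by simp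
  moreover have "of_nat (num_gmaps G T T) dvd (\<Sum>U\<in>classes_below T. \<Sum>s\<in>End T. ?t U s)"
  proof (rule dvd_sum)
    fix U assume "U \<in> classes_below T"
    then have U: "fdt_gset G TG (class_rep U)" using fdt_class_rep(2) by blast
    have "\<forall>s\<in>End T. \<exists>p. p \<in> gmaps G (class_rep T) (class_rep (?V s)) \<and>
      (\<forall>x\<in>fst (class_rep T). \<forall>y\<in>fst (class_rep T). p x = p y \<longleftrightarrow> (x, y) \<in> orbit_rel (class_rep T) s)"
      using orbit_class(2)[OF T] by blast
    from bchoice[OF this] obtain p where p: "\<forall>s\<in>End T. p s \<in> gmaps G (class_rep T) (class_rep (?V s)) \<and>
      (\<forall>x\<in>fst (class_rep T). \<forall>y\<in>fst (class_rep T). p s x = p s y \<longleftrightarrow> (x, y) \<in> orbit_rel (class_rep T) s)" ..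
    show "of_nat (num_gmaps G T T) dvd (\<Sum>s\<in>End T. ?t U s)"
      unfolding num_gmaps_def class_card_def
    proof (rule burnside_congruence[OF fdt_class_rep(2)[OF T] U])
      show "fdt_gset G TG (class_rep (?V s))" if "s \<in> End T" for s
        using fdt_class_rep(2)[OF orbit_class(1)[OF T that]] .
      show "p s \<in> gmaps G (class_rep T) (class_rep (?V s))" if "s \<in> End T" for s
        using p that by blast
      show "p s x = p s y \<longleftrightarrow> (x, y) \<in> orbit_rel (class_rep T) s"
        if "s \<in> End T" "x \<in> fst (class_rep T)" "y \<in> fst (class_rep T)" for s x y
        using p that by blast
    qed
  qed
  ultimately show ?thesis by (simp only:)
qed

lemma witt_poly_cong:
  assumes "\<And>U. U \<in> classes_below T \<Longrightarrow> x U = y U"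
  shows "witt_poly G TG T x = witt_poly G TG T y"
  unfolding witt_poly_def using assms by (intro sum.cong) auto

text \<open>Conversely, the congruences suffice: solve \<open>b T = W\<^sub>T(S)\<close> for \<open>S T\<close> by recursion on the cardinality of
  \<open>T\<close>.  The coefficient of \<open>S T\<close> is the number of automorphisms of \<open>T\<close>, so the remainder
  \<open>b T - W\<^sub>T(x)\<close> has to be divisible by it, where \<open>x\<close> consists of the components found so far and \<open>0\<close> at \<open>T\<close>.
  The congruence for \<open>b\<close> minus the congruence for \<open>x\<close> says just that: for every automorphism except
  the identity the quotient of \<open>T\<close> is smaller than \<open>T\<close>, so its term vanishes by construction, and the
  identity contributes the remainder itself.\<close>

lemma ghost_image:
  fixes b :: "'a gclass \<Rightarrow> 'm::comm_monoid_add \<Rightarrow>\<^sub>0 int"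
  assumes cong: "\<And>T. T \<in> fdt_classes G TG \<Longrightarrow> of_nat (num_gmaps G T T) dvd
    (\<Sum>s\<in>End T. adams (class_card T div class_card (orbit_class T s)) (b (orbit_class T s)))"
  shows "\<exists>S. (\<forall>T\<in>fdt_classes G TG. b T = witt_poly G TG T S) \<and> (\<forall>T. T \<notin> fdt_classes G TG \<longrightarrow> S T = 0)"
proof -
  define step where "step S T r \<longleftrightarrow> (if T \<in> fdt_classes G TG then
      b T = (\<Sum>U\<in>classes_below T - {T}. of_nat (num_gmaps G T U) * S U ^ (class_card T div class_card U))
            + of_nat (num_gmaps G T T) * r else r = 0)" for S :: "'a gclass \<Rightarrow> 'm \<Rightarrow>\<^sub>0 int" and T r
  have step_iff: "step S T (S T) \<longleftrightarrow> (if T \<in> fdt_classes G TG then b T = witt_poly G TG T S else S T = 0)" for S T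
    by (simp add: step_def witt_poly_split)
  have "\<exists>S. \<forall>T. step S T (S T)"
  proof (rule dependent_wf_choice[OF wf_measure[of class_card]])
    fix S S' :: "'a gclass \<Rightarrow> 'm \<Rightarrow>\<^sub>0 int" and T r
    assume eq: "\<And>U. (U, T) \<in> Wellfounded.measure class_card \<Longrightarrow> S U = S' U"
    have "(\<Sum>U\<in>classes_below T - {T}. of_nat (num_gmaps G T U) * S U ^ (class_card T div class_card U))
        = (\<Sum>U\<in>classes_below T - {T}. of_nat (num_gmaps G T U) * S' U ^ (class_card T div class_card U))"
      if "T \<in> fdt_classes G TG"
      using class_card_less[OF that] eq by (intro sum.cong) auto
    then show "step S T r = step S' T r" by (auto simp: step_def)
  next
    fix T and S :: "'a gclass \<Rightarrow> 'm \<Rightarrow>\<^sub>0 int"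
    assume IH: "\<And>U. (U, T) \<in> Wellfounded.measure class_card \<Longrightarrow> step S U (S U)"
    show "\<exists>r. step S T r"
    proof (cases "T \<in> fdt_classes G TG")
      case T: True
      define x where "x = S(T := 0)"
      let ?id = "\<lambda>t\<in>fst (class_rep T). t"
      let ?d = "\<lambda>V. b V - witt_poly G TG V x"
      have smaller: "?d V = 0" if V: "V \<in> classes_below T - {T}" for V
      proof -
        have lt: "class_card V < class_card T" using class_card_less[OF T V] .
        have "x U = S U" if "U \<in> classes_below V" for U
          using class_le_card[of V U] that V lt by (auto simp: x_def)
        then have "witt_poly G TG V x = witt_poly G TG V S" by (rule witt_poly_cong)
        moreover have "b V = witt_poly G TG V S" using IH[of V] lt V by (simp add: step_iff)
        ultimately show ?thesis by simp
      qed
      have id: "?id \<in> End T" using gmaps_id[OF fdt_class_rep(2)[OF T]] .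
      have "of_nat (num_gmaps G T T) dvd
          (\<Sum>s\<in>End T. adams (class_card T div class_card (orbit_class T s)) (?d (orbit_class T s)))"
        using dvd_diff[OF cong[OF T] ghost_congruence[OF T, of x]]
        by (simp add: adams_diff sum_subtractf)
      also have "(\<Sum>s\<in>End T. adams (class_card T div class_card (orbit_class T s)) (?d (orbit_class T s)))
          = (\<Sum>s\<in>{?id}. adams (class_card T div class_card (orbit_class T s)) (?d (orbit_class T s)))"
      proof (rule sum.mono_neutral_right[OF finite_End[OF T]])
        show "\<forall>s\<in>End T - {?id}. adams (class_card T div class_card (orbit_class T s)) (?d (orbit_class T s)) = 0"
        proof
          fix s assume s: "s \<in> End T - {?id}"
          then have "orbit_class T s \<in> classes_below T - {T}"
            using orbit_class(1)[OF T] orbit_class_le[OF T] orbit_class_eq_iff[OF T] by simp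
          then have "?d (orbit_class T s) = 0" by (rule smaller)
          then show "adams (class_card T div class_card (orbit_class T s)) (?d (orbit_class T s)) = 0" by simp
        qed
      qed (use id in simp)
      also have "\<dots> = ?d T"
      proof -
        have "orbit_class T ?id = T" using orbit_class_eq_iff[OF T id] by simp
        moreover have "class_card T div class_card T = 1" using class_card_pos[OF T] by simp
        ultimately show ?thesis by simp
      qed
      finally obtain r where r: "?d T = of_nat (num_gmaps G T T) * r" by (auto simp: dvd_def)
      have "witt_poly G TG T x =
        (\<Sum>U\<in>classes_below T - {T}. of_nat (num_gmaps G T U) * S U ^ (class_card T div class_card U))"
        unfolding witt_poly_split[OF T] by (auto simp: x_def intro!: sum.cong)
      with r have "step S T r" using T by (simp add: step_def algebra_simps)
      then show ?thesis ..
    qed (simp add: step_def)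
  qed
  then obtain S where "\<And>T. step S T (S T)" by blast
  then show ?thesis unfolding step_iff by (intro exI[of _ S]) (auto split: if_splits)
qed

lemma witt_poly_inj:
  fixes S S' :: "'a gclass \<Rightarrow> 'm::comm_monoid_add \<Rightarrow>\<^sub>0 int"
  assumes eq: "\<And>T. T \<in> fdt_classes G TG \<Longrightarrow> witt_poly G TG T S = witt_poly G TG T S'"
  shows "T \<in> fdt_classes G TG \<Longrightarrow> S T = S' T"
proof (induction T rule: measure_induct_rule[of class_card])
  case (less T)
  have "(\<Sum>U\<in>classes_below T - {T}. of_nat (num_gmaps G T U) * S U ^ (class_card T div class_card U))
      = (\<Sum>U\<in>classes_below T - {T}. of_nat (num_gmaps G T U) * S' U ^ (class_card T div class_card U))"
    using class_card_less[OF less.prems] less.IH by (intro sum.cong) auto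
  then have "of_nat (num_gmaps G T T) * S T = of_nat (num_gmaps G T T) * S' T"
    using eq[OF less.prems] unfolding witt_poly_split[OF less.prems] by simp
  then show ?case using num_gmaps_pos[OF less.prems] by (rule of_nat_mult_cancel)
qed

text \<open>The theorem of Dress and Siebeneicher for addition.  The congruences are additive, so they pass from the
  two families of variables to the sum of their Witt polynomials.\<close>

lemma witt_sum_polys:
  shows "T \<in> fdt_classes G TG \<Longrightarrow>
    witt_poly G TG T var_X + witt_poly G TG T var_Y = witt_poly G TG T (witt_sum_polys G TG)"
proof -
  let ?R = "\<lambda>S. (\<forall>T \<in> fdt_classes G TG. witt_poly G TG T var_X + witt_poly G TG T var_Y = witt_poly G TG T S) \<and>
     (\<forall>T. T \<notin> fdt_classes G TG \<longrightarrow> S T = 0)"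
  have "\<exists>S. ?R S"
  proof (rule ghost_image)
    fix T assume T: "T \<in> fdt_classes G TG"
    show "of_nat (num_gmaps G T T) dvd
      (\<Sum>s\<in>End T. adams (class_card T div class_card (orbit_class T s))
         (witt_poly G TG (orbit_class T s) var_X + witt_poly G TG (orbit_class T s) var_Y))"
      unfolding adams_add sum.distrib by (intro dvd_add ghost_congruence T)
  qed
  moreover have "S = S'" if "?R S" "?R S'" for S S'
  proof
    fix T
    have "witt_poly G TG T S = witt_poly G TG T S'" if "T \<in> fdt_classes G TG" for T
      using \<open>?R S\<close> \<open>?R S'\<close> that by metis
    then show "S T = S' T"
      using witt_poly_inj[of S S' T] that by (cases "T \<in> fdt_classes G TG") auto
  qed
  ultimately have "\<exists>!S. ?R S" by blast
  from theI'[OF this] show "T \<in> fdt_classes G TG \<Longrightarrow>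
      witt_poly G TG T var_X + witt_poly G TG T var_Y = witt_poly G TG T (witt_sum_polys G TG)"
    unfolding witt_sum_polys_def[symmetric] by blast
qed

text \<open>The polynomial \<open>S\<^sub>T\<close> inherits both properties from the Witt polynomials in its recursive description:
  division by a positive integer does not change the set of monomials that occur.\<close>

lemma witt_sum_polys_in:
  "T \<in> fdt_classes G TG \<Longrightarrow> witt_sum_polys G TG T \<in> poly_in (Inl ` classes_below T \<union> Inr ` classes_below T)"
proof (induction T rule: measure_induct_rule[of class_card])
  case (less T)
  let ?J = "poly_in (Inl ` classes_below T \<union> Inr ` classes_below T)"
  let ?S = "witt_sum_polys G TG"
  have S: "?S U \<in> ?J" if U: "U \<in> classes_below T - {T}" for U
  proof (rule poly_in_mono)
    show "?S U \<in> poly_in (Inl ` classes_below U \<union> Inr ` classes_below U)"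
      using less.IH[OF class_card_less[OF less.prems U]] U by simp
    show "Inl ` classes_below U \<union> Inr ` classes_below U \<subseteq> Inl ` classes_below T \<union> Inr ` classes_below T"
      using class_le_trans[OF less.prems, of _ U] U by blast
  qed
  have XY: "witt_poly G TG T var_X \<in> ?J" "witt_poly G TG T var_Y \<in> ?J"
    unfolding witt_poly_def
    by (intro poly_in_sum poly_in_of_nat_mult poly_in_power class_card_div_pos[OF less.prems] var_X_in var_Y_in; blast)+
  have sum: "(\<Sum>U\<in>classes_below T - {T}. of_nat (num_gmaps G T U) * ?S U ^ (class_card T div class_card U)) \<in> ?J"
    by (intro poly_in_sum poly_in_of_nat_mult poly_in_power class_card_div_pos[OF less.prems] S; blast)
  have "of_nat (num_gmaps G T T) * ?S T = (witt_poly G TG T var_X + witt_poly G TG T var_Y)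
      - (\<Sum>U\<in>classes_below T - {T}. of_nat (num_gmaps G T U) * ?S U ^ (class_card T div class_card U))"
    unfolding witt_sum_polys[OF less.prems] witt_poly_split[OF less.prems, of ?S] by simp
  also have "\<dots> \<in> ?J"
    by (intro poly_in_diff poly_in_add XY sum)
  finally show ?case
    using poly_in_of_nat_mult_iff[OF num_gmaps_pos[OF less.prems]] by blast
qed

end

section \<open>The ideals and the two topologies\<close>

context cring
begin

lemma finprod_zero:
  assumes "finite I" "i \<in> I" "f i = \<zero>" "f \<in> I \<rightarrow> carrier R"
  shows "finprod R f I = \<zero>"
proof -
  have "finprod R f (insert i (I - {i})) = f i \<otimes> finprod R f (I - {i})"
    using assms by (intro finprod_insert) auto
  moreover have "finprod R f (I - {i}) \<in> carrier R" using assms by (intro finprod_closed) auto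
  ultimately show ?thesis using assms by (simp add: insert_absorb)
qed

lemma eval_poly2_closed:
  assumes "p \<in> poly_in D" "\<And>v. v \<in> D \<Longrightarrow> case_sum a b v \<in> carrier R"
  shows "eval_poly2 R a b p \<in> carrier R"
proof -
  have "case_sum a b v \<in> carrier R" if "m \<in> Poly_Mapping.keys p" "v \<in> Poly_Mapping.keys m" for m v
    using assms that unfolding poly_in_def by blast
  then show ?thesis
    unfolding eval_poly2_def by (intro finsum_closed Pi_I add.int_pow_closed finprod_closed nat_pow_closed) auto
qed

lemma eval_poly2_zero:
  assumes "p \<in> poly_in D" "\<And>v. v \<in> D \<Longrightarrow> case_sum a b v = \<zero>"
  shows "eval_poly2 R a b p = \<zero>"
  unfolding eval_poly2_def
proof (rule add.finprod_one_eqI)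
  fix m assume m: "m \<in> Poly_Mapping.keys p"
  have zero: "case_sum a b v [^] Poly_Mapping.lookup m v = \<zero>" if v: "v \<in> Poly_Mapping.keys m" for v
  proof -
    have "case_sum a b v = \<zero>" using assms m v unfolding poly_in_def by blast
    then show ?thesis using v by (simp add: in_keys_iff nat_pow_zero)
  qed
  have "m \<noteq> 0" using assms(1) m unfolding poly_in_def by blast
  then obtain v where "Poly_Mapping.lookup m v \<noteq> 0" by (metis poly_mapping_eqI lookup_zero)
  then have "v \<in> Poly_Mapping.keys m" by (simp add: in_keys_iff)
  then have "(\<Otimes>v\<in>Poly_Mapping.keys m. case_sum a b v [^] Poly_Mapping.lookup m v) = \<zero>"
    using zero by (intro finprod_zero[of _ v]) auto
  then show "[Poly_Mapping.lookup p m] \<cdot> (\<Otimes>v\<in>Poly_Mapping.keys m. case_sum a b v [^] Poly_Mapping.lookup m v) = \<zero>"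
    by (simp add: add.int_pow_one)
qed

end

lemma carrier_witt_burnside: "carrier (witt_burnside G TG A) = fdt_classes G TG \<rightarrow>\<^sub>E carrier A"
  by (simp add: witt_burnside_def)

context profinite_group
begin

text \<open>By transitivity of \<open>\<le>\<close>, all variables that occur in \<open>S\<^sub>T\<close> with \<open>T \<le> G/N\<close> are evaluated at \<open>0\<close>, and
  \<open>S\<^sub>T\<close> has no constant term.\<close>

lemma witt_K_add:
  fixes A :: "('c, 'n) ring_scheme"
  assumes A: "cring A" and N: "open_normal G TG N" and a: "a \<in> witt_K G TG A N" and b: "b \<in> witt_K G TG A N"
  shows "a \<oplus>\<^bsub>witt_burnside G TG A\<^esub> b \<in> witt_K G TG A N"
proof -
  interpret A: cring A by (rule A)
  have Q: "quot_class G TG N \<in> fdt_classes G TG"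
    using N by (intro quot_class(1)) (auto simp: open_normal_def normal_def)
  have ab: "a \<in> fdt_classes G TG \<rightarrow>\<^sub>E carrier A" "b \<in> fdt_classes G TG \<rightarrow>\<^sub>E carrier A"
    using a b by (simp_all add: witt_K_def carrier_witt_burnside)
  have zero: "a U = \<zero>\<^bsub>A\<^esub>" "b U = \<zero>\<^bsub>A\<^esub>" if "U \<in> fdt_classes G TG" "class_le G U (quot_class G TG N)" for U
    using a b that by (simp_all add: witt_K_def)
  have sum: "(a \<oplus>\<^bsub>witt_burnside G TG A\<^esub> b) = (\<lambda>T\<in>fdt_classes G TG. eval_poly2 A a b (witt_sum_polys G TG T))"
    by (simp add: witt_burnside_def)
  show ?thesis
    unfolding witt_K_def carrier_witt_burnside
  proof (intro CollectI conjI ballI impI)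
    show "a \<oplus>\<^bsub>witt_burnside G TG A\<^esub> b \<in> fdt_classes G TG \<rightarrow>\<^sub>E carrier A"
      unfolding sum
    proof (rule restrict_PiE_iff[THEN iffD2], rule ballI)
      fix T assume T: "T \<in> fdt_classes G TG"
      show "eval_poly2 A a b (witt_sum_polys G TG T) \<in> carrier A"
        by (rule A.eval_poly2_closed[OF witt_sum_polys_in[OF T]]) (use ab in auto)
    qed
    fix T assume T: "T \<in> fdt_classes G TG" and le: "class_le G T (quot_class G TG N)"
    have "eval_poly2 A a b (witt_sum_polys G TG T) = \<zero>\<^bsub>A\<^esub>"
    proof (rule A.eval_poly2_zero[OF witt_sum_polys_in[OF T]])
      fix v assume "v \<in> Inl ` classes_below T \<union> Inr ` classes_below T"
      then obtain U where U: "U \<in> fdt_classes G TG" "class_le G U T" and v: "v = Inl U \<or> v = Inr U" by blast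
      show "case_sum a b v = \<zero>\<^bsub>A\<^esub>"
        using v zero[OF U(1) class_le_trans[OF Q U(2) le]] by auto
    qed
    then show "(a \<oplus>\<^bsub>witt_burnside G TG A\<^esub> b) T = \<zero>\<^bsub>A\<^esub>" using T by (simp add: sum)
  qed
qed

lemma witt_I_subset_K:
  assumes N: "open_normal G TG N"
  shows "witt_I G TG A (Suc (class_card (quot_class G TG N))) \<subseteq> witt_K G TG A N"
proof -
  have "quot_class G TG N \<in> fdt_classes G TG"
    using N by (intro quot_class(1)) (auto simp: open_normal_def normal_def)
  then have "class_card T < Suc (class_card (quot_class G TG N))"
    if "T \<in> fdt_classes G TG" "class_le G T (quot_class G TG N)" for T
    using class_le_card that by (simp add: less_Suc_eq_le)
  then show ?thesis by (auto simp: witt_I_def witt_K_def)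
qed

text \<open>Every neighbourhood \<open>a + I\<^sub>n\<close> of a point of \<open>K\<^sub>N\<close> stays in \<open>K\<^sub>N\<close> as soon as \<open>I\<^sub>n \<subseteq> K\<^sub>N\<close>, because \<open>K\<^sub>N\<close> is
  closed under addition.\<close>

lemma witt_K_open:
  assumes A: "cring A" and N: "open_normal G TG N"
  shows "openin (initial_vanishing_topology G TG A) (witt_K G TG A N)"
proof -
  let ?R = "witt_burnside G TG A" and ?n = "Suc (class_card (quot_class G TG N))"
  have "\<exists>L\<in>{witt_I G TG A n | n. 1 \<le> n}. L \<subseteq> I \<inter> J"
    if "I \<in> {witt_I G TG A n | n. 1 \<le> n}" "J \<in> {witt_I G TG A n | n. 1 \<le> n}" for I J
  proof -
    obtain m n where mn: "I = witt_I G TG A m" "J = witt_I G TG A n" "1 \<le> m" "1 \<le> n"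
      using \<open>I \<in> _\<close> \<open>J \<in> _\<close> by blast
    have "witt_I G TG A (max m n) \<subseteq> I \<inter> J" unfolding mn witt_I_def by auto
    then show ?thesis using mn by (intro bexI[of _ "witt_I G TG A (max m n)"]) auto
  qed
  then have open_iff: "openin (initial_vanishing_topology G TG A) = nbhd_open ?R {witt_I G TG A n | n. 1 \<le> n}"
    unfolding initial_vanishing_topology_def by (intro openin_nbhd_topology) blast
  have "a <+\<^bsub>?R\<^esub> witt_I G TG A ?n \<subseteq> witt_K G TG A N" if "a \<in> witt_K G TG A N" for a
    using witt_K_add[OF A N that] witt_I_subset_K[OF N, of A] by (auto simp: a_l_coset_def')
  moreover have "witt_I G TG A ?n \<in> {witt_I G TG A n | n. 1 \<le> n}" by force
  moreover have "witt_K G TG A N \<subseteq> carrier ?R" by (auto simp: witt_K_def)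
  ultimately show ?thesis unfolding open_iff nbhd_open_def by blast
qed

text \<open>The elements of \<open>G\<close> with which \<open>f\<close> commutes form a subgroup, which is closed because both actions
  are continuous with discrete target.\<close>

lemma dense_equivariant:
  assumes dense: "TG closure_of (generate G S) = carrier G" and S: "S \<subseteq> carrier G"
    and P: "fdt_gset G TG P" and Q: "fdt_gset G TG Q"
    and f: "\<And>x. x \<in> fst P \<Longrightarrow> f x \<in> fst Q"
    and equi: "\<And>s x. s \<in> S \<Longrightarrow> x \<in> fst P \<Longrightarrow> f (snd P s x) = snd Q s (f x)"
    and g: "g \<in> carrier G" and x: "x \<in> fst P"
  shows "f (snd P g x) = snd Q g (f x)"
proof -
  let ?E = "{g \<in> carrier G. \<forall>x\<in>fst P. f (snd P g x) = snd Q g (f x)}"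
  have "generate G S \<subseteq> ?E"
  proof
    fix h assume "h \<in> generate G S"
    then show "h \<in> ?E"
    proof (induction rule: generate.induct)
      case one
      then show ?case using fdt_one[OF P] fdt_one[OF Q] f by simp
    next
      case (incl h)
      then show ?case using equi S by blast
    next
      case (inv h)
      have h: "h \<in> carrier G" using inv S by blast
      have "f (snd P (inv h) x) = snd Q (inv h) (f x)" if x: "x \<in> fst P" for x
      proof -
        have y: "snd P (inv h) x \<in> fst P" using fdt_closed[OF P _ x] h by simp
        have "snd P h (snd P (inv h) x) = x"
          using fdt_mult[OF P h _ x, of "inv h"] fdt_one[OF P x] h by simp
        then have "f x = snd Q h (f (snd P (inv h) x))" using equi[OF inv y] by simp
        then have "snd Q (inv h) (f x) = snd Q (inv h \<otimes> h) (f (snd P (inv h) x))"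
          using fdt_mult[OF Q _ h f[OF y], of "inv h"] h by simp
        then show ?thesis using fdt_one[OF Q f[OF y]] h by simp
      qed
      then show ?case using h by simp
    next
      case (eng h1 h2)
      then show ?case using fdt_mult[OF P] fdt_mult[OF Q] fdt_closed[OF P] f by simp
    qed
  qed
  moreover have "closedin TG ?E"
    unfolding closedin_def topspace_eq
  proof
    let ?I = "{(x, y, z). x \<in> fst P \<and> y \<in> fst P \<and> z \<in> fst Q \<and> z \<noteq> f y}"
    let ?O = "\<lambda>(x, y, z). {g \<in> carrier G. snd P g x = y} \<inter> {g \<in> carrier G. snd Q g (f x) = z}"
    have "carrier G - ?E = (\<Union>i\<in>?I. ?O i)"
    proof (intro equalityI subsetI)
      fix g assume "g \<in> carrier G - ?E"
      then obtain x where g: "g \<in> carrier G" and x: "x \<in> fst P" and "f (snd P g x) \<noteq> snd Q g (f x)"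
        by blast
      then have "(x, snd P g x, snd Q g (f x)) \<in> ?I"
        using fdt_closed[OF P g x] fdt_closed[OF Q g f[OF x]] by auto
      then show "g \<in> (\<Union>i\<in>?I. ?O i)" using g by (intro UN_I[of "(x, snd P g x, snd Q g (f x))"]) simp_all
    next
      fix g assume "g \<in> (\<Union>i\<in>?I. ?O i)"
      then obtain x where "g \<in> carrier G" and x: "x \<in> fst P" and ne: "f (snd P g x) \<noteq> snd Q g (f x)"
        by auto
      moreover have "g \<notin> ?E" using x ne by blast
      ultimately show "g \<in> carrier G - ?E" by blast
    qed
    also have "openin TG \<dots>"
      using fdt_open[OF P] fdt_open[OF Q] f by (intro openin_Union) (auto intro!: openin_Int)
    finally show "openin TG (carrier G - ?E)" .
  qed auto
  ultimately have "TG closure_of (generate G S) \<subseteq> ?E" by (rule closure_of_minimal)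
  then have "carrier G \<subseteq> ?E" unfolding dense .
  then show ?thesis using g x by blast
qed

text \<open>After numbering the points of \<open>T\<close>, the class \<open>T\<close> is determined by the permutations by which the finitely
  many topological generators act.\<close>

lemma finite_small_classes:
  assumes "topologically_fg G TG"
  shows "finite {T \<in> fdt_classes G TG. class_card T < n}"
proof -
  obtain S where S: "finite S" "S \<subseteq> carrier G" and dense: "TG closure_of (generate G S) = carrier G"
    using assms by (auto simp: topologically_fg_def)
  let ?F = "{T \<in> fdt_classes G TG. class_card T < n}"
  have "\<forall>T\<in>?F. \<exists>e. bij_betw e (fst (class_rep T)) {..<class_card T}"
  proof
    fix T assume "T \<in> ?F"
    then have "finite (fst (class_rep T))" using fdt_finite[OF fdt_class_rep(2)] by blast
    from ex_bij_betw_finite_nat[OF this] show "\<exists>e. bij_betw e (fst (class_rep T)) {..<class_card T}"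
      by (simp add: class_card_def atLeast0LessThan)
  qed
  from bchoice[OF this] obtain e
    where e: "\<And>T. T \<in> ?F \<Longrightarrow> bij_betw (e T) (fst (class_rep T)) {..<class_card T}" by blast
  define d where "d T = (class_card T, \<lambda>s\<in>S. \<lambda>i\<in>{..<class_card T}.
      e T (snd (class_rep T) s (inv_into (fst (class_rep T)) (e T) i)))" for T
  have d_apply: "snd (d T) s (e T x) = e T (snd (class_rep T) s x)"
    if T: "T \<in> ?F" and s: "s \<in> S" and x: "x \<in> fst (class_rep T)" for T s x
  proof -
    have "e T x < class_card T" "inv_into (fst (class_rep T)) (e T) (e T x) = x"
      using e[OF T] x by (auto simp: bij_betw_def)
    then show ?thesis using s by (simp add: d_def)
  qed
  have "inj_on d ?F"
  proof (rule inj_onI)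
    fix T U assume T: "T \<in> ?F" and U: "U \<in> ?F" and eq: "d T = d U"
    let ?P = "class_rep T" and ?Q = "class_rep U"
    have P: "fdt_gset G TG ?P" and Q: "fdt_gset G TG ?Q" using T U fdt_class_rep(2) by blast+
    have card: "class_card T = class_card U" using eq by (simp add: d_def)
    define f where "f = (\<lambda>x\<in>fst ?P. inv_into (fst ?Q) (e U) (e T x))"
    have bij: "bij_betw f (fst ?P) (fst ?Q)"
      using bij_betw_trans[OF e[OF T] bij_betw_inv_into[OF e[OF U], folded card]]
      by (simp add: f_def comp_def cong: bij_betw_cong)
    have f: "f x \<in> fst ?Q" "e U (f x) = e T x" if "x \<in> fst ?P" for x
    proof -
      show "f x \<in> fst ?Q" using bij that by (auto simp: bij_betw_def)
      have "e T x \<in> e U ` fst ?Q" using e[OF T] e[OF U] that card by (auto simp: bij_betw_def)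
      then show "e U (f x) = e T x" using that by (simp add: f_def f_inv_into_f)
    qed
    have equi: "f (snd ?P s x) = snd ?Q s (f x)" if s: "s \<in> S" and x: "x \<in> fst ?P" for s x
    proof -
      have sG: "s \<in> carrier G" using s S by blast
      have "e U (f (snd ?P s x)) = e T (snd ?P s x)" using f(2) fdt_closed[OF P sG x] by blast
      also have "\<dots> = snd (d U) s (e U (f x))" using d_apply[OF T s x] eq f(2)[OF x] by simp
      also have "\<dots> = e U (snd ?Q s (f x))" using d_apply[OF U s f(1)[OF x]] .
      finally show ?thesis
        using inj_onD[OF bij_betw_imp_inj_on[OF e[OF U]]] f(1) fdt_closed[OF P sG x] fdt_closed[OF Q sG] x by blast
    qed
    have "f \<in> gmaps G ?P ?Q"
    proof (rule gmapsI)
      show "f \<in> extensional (fst ?P)" by (simp add: f_def)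
      show "f x \<in> fst ?Q" if "x \<in> fst ?P" for x by (rule f(1)[OF that])
      show "f (snd ?P g x) = snd ?Q g (f x)" if "g \<in> carrier G" "x \<in> fst ?P" for g x
        using that by (intro dense_equivariant[OF dense S(2) P Q f(1) equi])
    qed
    then show "T = U" using fdt_classes_eqI[of T U] T U bij by (auto simp: gset_iso_def)
  qed
  moreover have "d ` ?F \<subseteq> (SIGMA k:{..<n}. S \<rightarrow>\<^sub>E ({..<k} \<rightarrow>\<^sub>E {..<k}))"
  proof
    fix z assume "z \<in> d ` ?F"
    then obtain T where T: "T \<in> ?F" and z: "z = d T" by blast
    have P: "fdt_gset G TG (class_rep T)" using T fdt_class_rep(2) by blast
    have "e T (snd (class_rep T) s (inv_into (fst (class_rep T)) (e T) i)) < class_card T"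
      if "s \<in> S" "i < class_card T" for s i
    proof -
      have "inv_into (fst (class_rep T)) (e T) i \<in> fst (class_rep T)"
        using bij_betw_inv_into[OF e[OF T]] that(2) by (auto simp: bij_betw_def)
      then have "snd (class_rep T) s (inv_into (fst (class_rep T)) (e T) i) \<in> fst (class_rep T)"
        using fdt_closed[OF P] S(2) that(1) by blast
      then show ?thesis using e[OF T] by (auto simp: bij_betw_def)
    qed
    then show "z \<in> (SIGMA k:{..<n}. S \<rightarrow>\<^sub>E ({..<k} \<rightarrow>\<^sub>E {..<k}))"
      using T by (auto simp: z d_def)
  qed
  moreover have "finite (SIGMA k:{..<n}. S \<rightarrow>\<^sub>E ({..<k} \<rightarrow>\<^sub>E {..<k}))"
    using S(1) by (intro finite_SigmaI finite_PiE) auto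
  ultimately show ?thesis using finite_subset finite_imageD by blast
qed

text \<open>The elements that act trivially on all members of a finite family form an open normal subgroup \<open>N\<close>.
  Each member \<open>T\<close> is then a quotient of \<open>G/N\<close>, by \<open>g N \<mapsto> g x\<close> for any point \<open>x\<close> of \<open>T\<close>.\<close>

lemma small_classes_kernel:
  assumes "finite \<F>" "\<F> \<subseteq> fdt_classes G TG"
  shows "\<exists>N. open_normal G TG N \<and> (\<forall>T\<in>\<F>. class_le G T (quot_class G TG N))"
proof -
  define N where "N = {g \<in> carrier G. \<forall>T\<in>\<F>. \<forall>x\<in>fst (class_rep T). snd (class_rep T) g x = x}"
  have fdt: "fdt_gset G TG (class_rep T)" if "T \<in> \<F>" for T using that assms fdt_class_rep(2) by blast
  have "subgroup N G"
  proof (rule subgroupI)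
    show "N \<subseteq> carrier G" by (auto simp: N_def)
    have "\<one> \<in> N" using fdt_one[OF fdt] by (simp add: N_def)
    then show "N \<noteq> {}" by blast
    show "inv g \<in> N" if g: "g \<in> N" for g
    proof -
      have gG: "g \<in> carrier G" using g by (simp add: N_def)
      have "snd (class_rep T) (inv g) x = x" if T: "T \<in> \<F>" "x \<in> fst (class_rep T)" for T x
      proof -
        have "snd (class_rep T) (inv g) (snd (class_rep T) g x) = x"
          using fdt_mult[OF fdt[OF T(1)] _ gG T(2), of "inv g"] fdt_one[OF fdt[OF T(1)] T(2)] gG by simp
        then show ?thesis using g T by (simp add: N_def)
      qed
      then show ?thesis using gG by (simp add: N_def)
    qed
    show "g \<otimes> h \<in> N" if "g \<in> N" "h \<in> N" for g h
      using that fdt_mult[OF fdt] by (simp add: N_def)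
  qed
  moreover have "g \<otimes> h \<otimes> inv g \<in> N" if g: "g \<in> carrier G" and h: "h \<in> N" for g h
  proof -
    have hG: "h \<in> carrier G" using h by (simp add: N_def)
    have "snd (class_rep T) (g \<otimes> h \<otimes> inv g) x = x" if T: "T \<in> \<F>" "x \<in> fst (class_rep T)" for T x
    proof -
      note a = fdt_mult[OF fdt[OF T(1)]] fdt_closed[OF fdt[OF T(1)]]
      have y: "snd (class_rep T) (inv g) x \<in> fst (class_rep T)" using a(2)[OF _ T(2)] g by simp
      have "snd (class_rep T) (g \<otimes> h \<otimes> inv g) x
          = snd (class_rep T) g (snd (class_rep T) h (snd (class_rep T) (inv g) x))"
        using a(1)[of "g \<otimes> h" "inv g" x] a(1)[OF g hG y] g hG T(2) by simp
      also have "\<dots> = snd (class_rep T) (g \<otimes> inv g) x"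
        using h T(1) y a(1)[OF g _ T(2), of "inv g"] g by (simp add: N_def)
      also have "\<dots> = x" using fdt_one[OF fdt[OF T(1)] T(2)] g by simp
      finally show ?thesis .
    qed
    then show ?thesis using g hG by (simp add: N_def)
  qed
  ultimately have normal: "N \<lhd> G" by (auto simp: normal_inv_iff)
  have "openin TG ((\<Inter>(T, x)\<in>(SIGMA T:\<F>. fst (class_rep T)). {g \<in> carrier G. snd (class_rep T) g x = x}) \<inter> topspace TG)"
    using assms(1) fdt_finite[OF fdt] fdt_open[OF fdt] by (intro openin_INT) auto
  also have "(\<Inter>(T, x)\<in>(SIGMA T:\<F>. fst (class_rep T)). {g \<in> carrier G. snd (class_rep T) g x = x}) \<inter> topspace TG = N"
    by (auto simp: N_def topspace_eq)
  finally have N: "open_normal G TG N" using normal by (simp add: open_normal_def)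
  have "class_le G T (quot_class G TG N)" if T: "T \<in> \<F>" for T
  proof -
    let ?P = "class_rep T"
    note P = fdt[OF T]
    have sub: "subgroup N G" "openin TG N" using N by (auto simp: open_normal_def normal_def)
    interpret N: subgroup N G by (rule sub(1))
    obtain x where x: "x \<in> fst ?P" using fdt_nonempty[OF P] by blast
    define f where "f = (\<lambda>C\<in>lcosets N. snd ?P (SOME g. g \<in> C) x)"
    have f: "f (g <# N) = snd ?P g x" if g: "g \<in> carrier G" for g
    proof -
      have "(SOME h. h \<in> g <# N) \<in> g <# N" using lcos_self[OF g sub(1)] by (rule someI)
      then obtain h where h: "h \<in> N" "(SOME h. h \<in> g <# N) = g \<otimes> h" by (auto simp: l_coset_def)
      have "g <# N \<in> lcosets N" using g by (auto simp: LCOSETS_def)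
      then have "f (g <# N) = snd ?P (g \<otimes> h) x" using h(2) by (simp add: f_def)
      also have "\<dots> = snd ?P g x"
      proof -
        have "h \<in> carrier G" "snd ?P h x = x" using h(1) T x unfolding N_def by blast+
        then show ?thesis using fdt_mult[OF P g _ x, of h] by simp
      qed
      finally show ?thesis .
    qed
    have "f \<in> gmaps G (coset_gset G N) ?P"
    proof (rule gmapsI)
      show "f \<in> extensional (fst (coset_gset G N))" by (simp add: f_def coset_gset_def)
      fix C assume "C \<in> fst (coset_gset G N)"
      then obtain h where h: "h \<in> carrier G" and C: "C = h <# N" "C \<in> lcosets N"
        by (auto simp: coset_gset_def LCOSETS_def)
      show "f C \<in> fst ?P" using f[OF h] C fdt_closed[OF P h x] by simp
      show "f (snd (coset_gset G N) g C) = snd ?P g (f C)" if g: "g \<in> carrier G" for g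
      proof -
        have "snd (coset_gset G N) g C = (g \<otimes> h) <# N"
          using C g h by (simp add: coset_gset_def lcos_m_assoc N.subset)
        then show ?thesis using f[of "g \<otimes> h"] f[OF h] fdt_mult[OF P g h x] g h C by simp
      qed
    qed
    moreover obtain q where "q \<in> gmaps G (class_rep (quot_class G TG N)) (coset_gset G N)"
      using gset_iso_sym[OF coset_gset_fdt[OF sub] fdt_class_rep(2)[OF quot_class(1)[OF sub]] quot_class(2)[OF sub]]
      by (auto simp: gset_iso_def)
    ultimately show ?thesis
      unfolding class_le_def
      using gmaps_compose[OF fdt_class_rep(2)[OF quot_class(1)[OF sub]]] by blast
  qed
  then show ?thesis using N by blast
qed

lemma witt_K_subset_I:
  assumes "topologically_fg G TG"
  shows "\<exists>N. open_normal G TG N \<and> witt_K G TG A N \<subseteq> witt_I G TG A n"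
proof -
  obtain N where "open_normal G TG N"
    and "\<forall>T\<in>{T \<in> fdt_classes G TG. class_card T < n}. class_le G T (quot_class G TG N)"
    using small_classes_kernel[OF finite_small_classes[OF assms, of n]] by blast
  then show ?thesis by (intro exI[of _ N]) (auto simp: witt_I_def witt_K_def)
qed

end

lemma nbhd_open_coarser:
  assumes "\<And>I. I \<in> \<B> \<Longrightarrow> \<exists>J\<in>\<C>. J \<subseteq> I" "nbhd_open R \<B> V"
  shows "nbhd_open R \<C> V"
  unfolding nbhd_open_def
proof (intro conjI ballI)
  show "V \<subseteq> carrier R" using assms(2) by (simp add: nbhd_open_def)
  fix a assume "a \<in> V"
  then obtain I where I: "I \<in> \<B>" "a <+\<^bsub>R\<^esub> I \<subseteq> V" using assms(2) by (auto simp: nbhd_open_def)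
  then obtain J where "J \<in> \<C>" "J \<subseteq> I" using assms(1) by blast
  then show "\<exists>J\<in>\<C>. a <+\<^bsub>R\<^esub> J \<subseteq> V"
    using I(2) by (intro bexI[of _ J]) (auto simp: a_l_coset_def')
qed

theorem theorem3p16:
  fixes G :: "('g, 'm) monoid_scheme" and TG :: "'g topology" and A :: "('a, 'n) ring_scheme"
  assumes "profinite_group G TG" and "cring A"
  shows "(\<forall>N. open_normal G TG N \<longrightarrow>
            openin (initial_vanishing_topology G TG A) (witt_K G TG A N)) \<and>
         (topologically_fg G TG \<longrightarrow>
            profinite_topology G TG A = initial_vanishing_topology G TG A)"
proof (intro conjI allI impI)
  interpret profinite_group G TG by (rule assms(1))
  show "openin (initial_vanishing_topology G TG A) (witt_K G TG A N)" if "open_normal G TG N" for N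
    using witt_K_open[OF assms(2) that] .
  assume fg: "topologically_fg G TG"
  let ?K = "{witt_K G TG A N | N. open_normal G TG N}" and ?I = "{witt_I G TG A n | n. 1 \<le> n}"
  have "\<exists>J\<in>?I. J \<subseteq> K" if "K \<in> ?K" for K
    using that witt_I_subset_K[of _ A] by force
  moreover have "\<exists>K\<in>?K. K \<subseteq> J" if "J \<in> ?I" for J
    using that witt_K_subset_I[OF fg, of A] by blast
  ultimately have "nbhd_open (witt_burnside G TG A) ?K = nbhd_open (witt_burnside G TG A) ?I"
    using nbhd_open_coarser[of ?K ?I "witt_burnside G TG A"] nbhd_open_coarser[of ?I ?K "witt_burnside G TG A"]
    by blast
  then show "profinite_topology G TG A = initial_vanishing_topology G TG A"
    by (simp add: profinite_topology_def initial_vanishing_topology_def nbhd_topology_def)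
qed

end
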